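(* For every $\mathsf{SKS}$ derivation $\Phi$ there exists an $\mathsf{SKS}$ derivation with the same premiss and conclusion as $\Phi$ whose associated atomic flow is cycle-free.
   Context: Formulae are built from the units $\mathsf f$ and $\mathsf t$, atoms, disjunction $[\alpha\vee\beta]$ and conjunction $(\alpha\wedge\beta)$; on atoms there is an involution $a\mapsto\bar a$ with $\bar a\neq a$. An inference step of a rule $\alpha/\beta$ rewrites $\xi\{\alpha\}$ into $\xi\{\beta\}$ for an arbitrary context (formula with a hole) $\xi$. A derivation from $\alpha$ (premiss) to $\beta$ (conclusion) is a finite chain of steps from $\alpha$ to $\beta$. System $\mathsf{SKS}$: interaction $\mathsf t/[a\vee\bar a]$; weakening $\mathsf f/a$; contraction $[a\vee a]/a$; cut $(a\wedge\bar a)/\mathsf f$; coweakening $a/\mathsf t$; cocontraction $a/(a\wedge a)$; switch $(\alpha\wedge[\beta\vee\gamma])/[(\alpha\wedge\beta)\vee\gamma]$; medial $[(\alpha\wedge\beta)\vee(\gamma\wedge\delta)]/([\alpha\vee\gamma]\wedge[\beta\vee\delta])$; and $\gamma/\delta$ whenever $\gamma=\delta$ is (either direction of) an instance of commutativity or associativity of $\vee,\wedge$, $[\alpha\vee\mathsf f]=\alpha$, $(\alpha\wedge\mathsf t)=\alpha$, $[\mathsf t\vee\mathsf t]=\mathsf t$, $(\mathsf f\wedge\mathsf f)=\mathsf f$. The atomic flow of an $\mathsf{SKS}$ derivation is a finite directed graph with vertices labelled interaction, cut, weakening, coweakening, contraction or cocontraction, and edges that may dangle at the top ($up=\top$) or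 bottom ($lo=\bot$): each atom occurrence is mapped to an edge by tracing occurrences through steps (occurrences in contexts and in the instantiated subformulae of switch, medial, $=$ keep their edge); each step of an atomic rule gives a vertex with that label whose upper edges ($lo(\epsilon)=\nu$) are the redex occurrences in the step's premiss and whose lower edges ($up(\epsilon)=\nu$) are those in its conclusion; occurrences in the premiss (conclusion) of the derivation have $up=\top$ ($lo=\bot$). A path from $\nu$ to $\nu'$ is a sequence of edges $\epsilon_1,\dots,\epsilon_h$ with $lo(\epsilon_i)=up(\epsilon_{i+1})$, $up(\epsilon_1)=\nu$, $lo(\epsilon_h)=\nu'$; its reversal is a path from $\nu'$ to $\nu$. An $\mathsf{ai}$-path from $\nu$ to $\nu'$ is either a path from $\nu$ to $\nu'$ or a sequence $\epsilon_1,\dots,\epsilon_k,\epsilon_{k+1},\dots,\epsilon_h$ with $\epsilon_k\neq\epsilon_{k+1}$ such that, for some interaction or cut vertex $\nu''$, $\epsilon_1,\dots,\epsilon_k$ is an $\mathsf{ai}$-path from $\nu$ to $\nu''$ and $\epsilon_{k+1},\dots,\epsilon_h$ is an $\mathsf{ai}$-path from $\nu''$ to $\nu'$. An $\mathsf{ai}$-cycle is an $\mathsf{ai}$-path from a vertex to itself in which no edge appears twice. A flow is cycle-free if it has no $\mathsf{ai}$-cycle. *)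

theory Defs
  imports Main
begin

datatype 'b fm = FF | TT | At 'b | Or "'b fm" "'b fm" | And "'b fm" "'b fm"

datatype 'b ctx = Hole | COrL "'b ctx" "'b fm" | COrR "'b fm" "'b ctx"
  | CAndL "'b ctx" "'b fm" | CAndR "'b fm" "'b ctx"

fun plug :: "'b ctx \<Rightarrow> 'b fm \<Rightarrow> 'b fm" where
  "plug Hole x = x"
| "plug (COrL C b) x = Or (plug C x) b"
| "plug (COrR a C) x = Or a (plug C x)"
| "plug (CAndL C b) x = And (plug C x) b"
| "plug (CAndR a C) x = And a (plug C x)"

fun occs :: "'b fm \<Rightarrow> 'b list" where
  "occs FF = []"
| "occs TT = []"
| "occs (At a) = [a]"
| "occs (Or x y) = occs x @ occs y"
| "occs (And x y) = occs x @ occs y"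

text \<open>To define atomic flows, every atom occurrence carries a tag (a natural number)
  naming the edge of the flow it is mapped to.\<close>

type_synonym 'a tfm = "('a \<times> nat) fm"

definition erase :: "'a tfm \<Rightarrow> 'a fm" where
  "erase \<phi> = map_fm fst \<phi>"

definition tags :: "'a tfm \<Rightarrow> nat list" where
  "tags \<phi> = map snd (occs \<phi>)"

datatype vkind = Interaction | Weakening | Contraction | Cut | Coweakening | Cocontraction

text \<open>Vertex information of an atomic step: label, upper edges (redex occurrences in the
  premiss), lower edges (redex occurrences in the conclusion).\<close>
type_synonym vinfo = "vkind \<times> nat list \<times> nat list"

text \<open>The basic equations (each may be used in either direction).\<close>
inductive eq_base :: "'b fm \<Rightarrow> 'b fm \<Rightarrow> bool" where
  or_comm: "eq_base (Or a b) (Or b a)"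
| and_comm: "eq_base (And a b) (And b a)"
| or_assoc: "eq_base (Or (Or a b) c) (Or a (Or b c))"
| and_assoc: "eq_base (And (And a b) c) (And a (And b c))"
| or_unit: "eq_base (Or a FF) a"
| and_unit: "eq_base (And a TT) a"
| tt_idem: "eq_base (Or TT TT) TT"
| ff_idem: "eq_base (And FF FF) FF"

text \<open>Instances of the rules of SKS on tagged formulae (the redex \<alpha> and its replacement
  \<beta> of a rule \<alpha>/\<beta>); the last argument is the vertex created (None for
  switch, medial and equality, whose instantiated subformulae keep their tags).
  bar is the involution on atoms.\<close>
inductive rule_inst :: "('a \<Rightarrow> 'a) \<Rightarrow> 'a tfm \<Rightarrow> 'a tfm \<Rightarrow> vinfo option \<Rightarrow> bool"
  for bar :: "'a \<Rightarrow> 'a" where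
  ai_down: "rule_inst bar TT (Or (At (a, i)) (At (bar a, j))) (Some (Interaction, [], [i, j]))"
| aw_down: "rule_inst bar FF (At (a, i)) (Some (Weakening, [], [i]))"
| ac_down: "rule_inst bar (Or (At (a, i)) (At (a, j))) (At (a, k)) (Some (Contraction, [i, j], [k]))"
| ai_up: "rule_inst bar (And (At (a, i)) (At (bar a, j))) FF (Some (Cut, [i, j], []))"
| aw_up: "rule_inst bar (At (a, i)) TT (Some (Coweakening, [i], []))"
| ac_up: "rule_inst bar (At (a, i)) (And (At (a, j)) (At (a, k))) (Some (Cocontraction, [i], [j, k]))"
| switch: "rule_inst bar (And x (Or y z)) (Or (And x y) z) None"
| medial: "rule_inst bar (Or (And x y) (And z w)) (And (Or x z) (Or y w)) None"
| eq_l: "eq_base x y \<Longrightarrow> rule_inst bar x y None"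
| eq_r: "eq_base y x \<Longrightarrow> rule_inst bar x y None"

text \<open>A step: context, redex in the premiss, redex in the conclusion, vertex info.\<close>
type_synonym 'a step = "('a \<times> nat) ctx \<times> 'a tfm \<times> 'a tfm \<times> vinfo option"

text \<open>A (tagged) derivation: the chain of formulae fs = [\<phi>0, ..., \<phi>n] and the steps.\<close>
type_synonym 'a deriv = "'a tfm list \<times> 'a step list"

definition step_info :: "'a step \<Rightarrow> vinfo option" where
  "step_info s = snd (snd (snd s))"

definition sks_deriv :: "('a \<Rightarrow> 'a) \<Rightarrow> 'a deriv \<Rightarrow> bool" where
  "sks_deriv bar D \<longleftrightarrow>
     (let fs = fst D; st = snd D in
      length fs = Suc (length st)
    \<and> (\<forall>k < length st. case st ! k of (C, r, r', v) \<Rightarrow>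
           fs ! k = plug C r \<and> fs ! Suc k = plug C r' \<and> rule_inst bar r r' v)
    \<comment> \<open>distinct occurrences in one formula are distinct edges\<close>
    \<and> (\<forall>k < length fs. distinct (tags (fs ! k)))
    \<comment> \<open>edges created by an atomic step are new\<close>
    \<and> (\<forall>k < length st. \<forall>c u l. step_info (st ! k) = Some (c, u, l) \<longrightarrow>
           (\<forall>e \<in> set l. \<forall>j \<le> k. e \<notin> set (tags (fs ! j)))))"

definition premiss :: "'a deriv \<Rightarrow> 'a fm" where
  "premiss D = erase (hd (fst D))"

definition conclusion :: "'a deriv \<Rightarrow> 'a fm" where
  "conclusion D = erase (last (fst D))"

text \<open>Nodes: the top and bottom dangling ends, and vertices (indexed by the step).
  Edges are tags.\<close>
datatype node = Top | Bot | V nat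

definition is_vertex :: "'a deriv \<Rightarrow> nat \<Rightarrow> bool" where
  "is_vertex D k \<longleftrightarrow> k < length (snd D) \<and> step_info (snd D ! k) \<noteq> None"

definition vertex_kind :: "'a deriv \<Rightarrow> nat \<Rightarrow> vkind" where
  "vertex_kind D k = fst (the (step_info (snd D ! k)))"

text \<open>up e = \<nu> and lo e = \<nu> (as relations; they are functional on derivations).\<close>
definition up_rel :: "'a deriv \<Rightarrow> nat \<Rightarrow> node \<Rightarrow> bool" where
  "up_rel D e \<nu> \<longleftrightarrow>
     (\<nu> = Top \<and> e \<in> set (tags (hd (fst D))))
   \<or> (\<exists>k c u l. \<nu> = V k \<and> k < length (snd D) \<and> step_info (snd D ! k) = Some (c, u, l) \<and> e \<in> set l)"

definition lo_rel :: "'a deriv \<Rightarrow> nat \<Rightarrow> node \<Rightarrow> bool" where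
  "lo_rel D e \<nu> \<longleftrightarrow>
     (\<nu> = Bot \<and> e \<in> set (tags (last (fst D))))
   \<or> (\<exists>k c u l. \<nu> = V k \<and> k < length (snd D) \<and> step_info (snd D ! k) = Some (c, u, l) \<and> e \<in> set u)"

definition dpath :: "'a deriv \<Rightarrow> node \<Rightarrow> node \<Rightarrow> nat list \<Rightarrow> bool" where
  "dpath D \<nu> \<nu>' es \<longleftrightarrow> es \<noteq> [] \<and> up_rel D (hd es) \<nu> \<and> lo_rel D (last es) \<nu>'
     \<and> (\<forall>i. Suc i < length es \<longrightarrow> (\<exists>\<mu>. lo_rel D (es ! i) \<mu> \<and> up_rel D (es ! Suc i) \<mu>))"

definition fpath :: "'a deriv \<Rightarrow> node \<Rightarrow> node \<Rightarrow> nat list \<Rightarrow> bool" where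
  "fpath D \<nu> \<nu>' es \<longleftrightarrow> dpath D \<nu> \<nu>' es \<or> dpath D \<nu>' \<nu> (rev es)"

inductive aipath :: "'a deriv \<Rightarrow> node \<Rightarrow> node \<Rightarrow> nat list \<Rightarrow> bool" for D where
  base: "fpath D \<nu> \<nu>' es \<Longrightarrow> aipath D \<nu> \<nu>' es"
| join: "\<lbrakk> aipath D \<nu> (V k) xs; aipath D (V k) \<nu>' ys; last xs \<noteq> hd ys;
          is_vertex D k; vertex_kind D k \<in> {Interaction, Cut} \<rbrakk>
         \<Longrightarrow> aipath D \<nu> \<nu>' (xs @ ys)"

definition cycle_free :: "'a deriv \<Rightarrow> bool" where
  "cycle_free D \<longleftrightarrow> \<not> (\<exists>k es. is_vertex D k \<and> aipath D (V k) (V k) es \<and> distinct es)"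

end

theory Submission
  imports Defs "HOL-Library.Multiset"
begin

(* Instead of transforming the given derivation we build a new one from its semantics. Soundness
  makes the conclusion B a consequence of the premiss A, and a restricted proof search yields
     A = A \<and> t  \<rightarrow>  A \<and> [B \<or> B']  \<rightarrow>  [(A \<and> B') \<or> B]  \<rightarrow>  [f \<or> B] = B,
  where [B \<or> B'] is built atom by atom with interactions (B' is the De Morgan dual of B) and
  A \<and> B' is refuted by a tableau using cut, weakening, coweakening, cocontraction, switch, medial
  and equations only. Each interaction thus has a lower edge that reaches the conclusion.
  Edges are numbered so that the parity of an edge is the polarity of its atom: every vertex
  except a cut preserves the parity along a directed path, and a cut joins edges of opposite
  parity. An ai-path may only turn at an interaction by using both of its lower edges, one of which
  leads to the bottom; hence a cycle descends from a vertex along two distinct lower edges to a cut.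
  These edges have different parities, which is impossible for a cocontraction, and both avoid the
  bottom, which is impossible for an interaction. *)

fun ctx_left :: "'b ctx \<Rightarrow> 'b list" where
  "ctx_left Hole = []"
| "ctx_left (COrL C b) = ctx_left C"
| "ctx_left (COrR a C) = occs a @ ctx_left C"
| "ctx_left (CAndL C b) = ctx_left C"
| "ctx_left (CAndR a C) = occs a @ ctx_left C"

fun ctx_right :: "'b ctx \<Rightarrow> 'b list" where
  "ctx_right Hole = []"
| "ctx_right (COrL C b) = ctx_right C @ occs b"
| "ctx_right (COrR a C) = ctx_right C"
| "ctx_right (CAndL C b) = ctx_right C @ occs b"
| "ctx_right (CAndR a C) = ctx_right C"

lemma occs_plug: "occs (plug C x) = ctx_left C @ occs x @ ctx_right C"
  by (induction C) auto

lemma tags_plug: "tags (plug C x) = map snd (ctx_left C) @ tags x @ map snd (ctx_right C)"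
  by (simp add: tags_def occs_plug)

lemma eq_base_mset_occs: "eq_base x y \<Longrightarrow> mset (occs x) = mset (occs y)"
  by (induction rule: eq_base.induct) (auto simp: ac_simps)

lemma rule_inst_None_mset_occs: "rule_inst bar r r' None \<Longrightarrow> mset (occs r') = mset (occs r)"
  by (erule rule_inst.cases) (auto dest: eq_base_mset_occs simp: ac_simps)

lemma rule_inst_None_set_occs: "rule_inst bar r r' None \<Longrightarrow> set (occs r') = set (occs r)"
  by (metis rule_inst_None_mset_occs set_mset_mset)

lemma rule_inst_Some_tags: "rule_inst bar r r' (Some (c, u, l)) \<Longrightarrow> tags r = u \<and> tags r' = l"
  by (erule rule_inst.cases) (auto simp: tags_def)

lemma sks_deriv_length: "sks_deriv bar (fs, st) \<Longrightarrow> length fs = Suc (length st)"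
  by (simp add: sks_deriv_def Let_def)

lemma sks_deriv_last: "sks_deriv bar (fs, st) \<Longrightarrow> last fs = fs ! length st"
  by (metis sks_deriv_length diff_Suc_1 last_conv_nth list.size(3) nat.distinct(1))

lemma sks_deriv_step:
  "sks_deriv bar (fs, st) \<Longrightarrow> k < length st
   \<Longrightarrow> \<exists>C r r' v. st ! k = (C, r, r', v) \<and> fs ! k = plug C r \<and> fs ! Suc k = plug C r' \<and> rule_inst bar r r' v"
  unfolding sks_deriv_def Let_def by (cases "st ! k") force

lemma erase_simps [simp]:
  "erase FF = FF" "erase TT = TT" "erase (At p) = At (fst p)"
  "erase (Or x y) = Or (erase x) (erase y)" "erase (And x y) = And (erase x) (erase y)"
  by (auto simp: erase_def)

section \<open>Paths in atomic flows\<close>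

lemma up_rel_V: "up_rel D e (V k) \<longleftrightarrow> (\<exists>c u l. k < length (snd D) \<and> step_info (snd D ! k) = Some (c, u, l) \<and> e \<in> set l)"
  by (auto simp: up_rel_def)

lemma lo_rel_V: "lo_rel D e (V k) \<longleftrightarrow> (\<exists>c u l. k < length (snd D) \<and> step_info (snd D ! k) = Some (c, u, l) \<and> e \<in> set u)"
  by (auto simp: lo_rel_def)

lemma dpath_inner_vertex:
  assumes "dpath D \<nu> \<nu>' es" "Suc i < length es"
  shows "\<exists>m. lo_rel D (es ! i) (V m) \<and> up_rel D (es ! Suc i) (V m)"
proof -
  obtain \<mu> where "lo_rel D (es ! i) \<mu>" "up_rel D (es ! Suc i) \<mu>"
    using assms by (auto simp: dpath_def)
  then show ?thesis
    by (cases \<mu>) (auto simp: up_rel_def lo_rel_def)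
qed

lemma dpath_ends:
  assumes "dpath D \<nu> \<nu>' es"
  shows "es \<noteq> []" "up_rel D (hd es) \<nu>" "lo_rel D (last es) \<nu>'"
  using assms by (simp_all add: dpath_def)

lemma fpath_rev: "fpath D \<nu> \<nu>' es \<Longrightarrow> fpath D \<nu>' \<nu> (rev es)"
  by (auto simp: fpath_def)

definition cut_fork :: "'a deriv \<Rightarrow> node \<Rightarrow> node \<Rightarrow> nat list \<Rightarrow> bool" where
  "cut_fork D \<nu> \<nu>' es \<longleftrightarrow> (\<exists>c xs ys. es = xs @ ys \<and> is_vertex D c \<and> vertex_kind D c = Cut
     \<and> dpath D \<nu> (V c) xs \<and> dpath D \<nu>' (V c) (rev ys) \<and> last xs \<noteq> hd ys)"

lemma cut_fork_rev:
  assumes "cut_fork D \<nu> \<nu>' es"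
  shows "cut_fork D \<nu>' \<nu> (rev es)"
proof -
  obtain c xs ys where es: "es = xs @ ys" and c: "is_vertex D c" "vertex_kind D c = Cut"
    and xs: "dpath D \<nu> (V c) xs" and ys: "dpath D \<nu>' (V c) (rev ys)" and junction: "last xs \<noteq> hd ys"
    using assms unfolding cut_fork_def by blast
  have "xs \<noteq> []" "ys \<noteq> []"
    using xs ys by (auto simp: dpath_def)
  then have "last (rev ys) \<noteq> hd (rev xs)"
    using junction by (simp add: last_rev hd_rev)
  moreover have "rev es = rev ys @ rev xs" "dpath D \<nu> (V c) (rev (rev xs))"
    using es xs by simp_all
  ultimately show ?thesis
    unfolding cut_fork_def using c ys by (intro exI[of _ c] exI[of _ "rev ys"] exI[of _ "rev xs"]) blast
qed

lemma path_arrival: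
  assumes "fpath D \<nu> (V k) xs \<or> cut_fork D \<nu> (V k) xs" "\<nu> \<noteq> Bot"
  shows "dpath D \<nu> (V k) xs \<or> (\<exists>\<mu> zs. \<mu> \<noteq> Bot \<and> dpath D (V k) \<mu> zs \<and> hd zs = last xs)"
  using assms(1)
proof
  assume "fpath D \<nu> (V k) xs"
  then show ?thesis
  proof (unfold fpath_def, elim disjE)
    assume "dpath D (V k) \<nu> (rev xs)"
    then show ?thesis
      using assms(2) by (intro disjI2 exI[of _ \<nu>] exI[of _ "rev xs"]) (simp add: hd_rev)
  qed simp
next
  assume "cut_fork D \<nu> (V k) xs"
  then obtain c xs1 xs2 where xs: "xs = xs1 @ xs2" and upward: "dpath D (V k) (V c) (rev xs2)"
    unfolding cut_fork_def by blast
  have "xs2 \<noteq> []"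
    using upward by (auto simp: dpath_def)
  then have "hd (rev xs2) = last xs"
    using xs by (simp add: hd_rev)
  moreover have "V c \<noteq> Bot"
    by simp
  ultimately show ?thesis
    using upward by (intro disjI2 exI[of _ "V c"] exI[of _ "rev xs2"]) blast
qed

lemma path_departure:
  assumes "fpath D (V k) \<nu> ys \<or> cut_fork D (V k) \<nu> ys" "\<nu> \<noteq> Bot"
  shows "dpath D \<nu> (V k) (rev ys) \<or> (\<exists>\<mu> zs. \<mu> \<noteq> Bot \<and> dpath D (V k) \<mu> zs \<and> hd zs = hd ys)"
proof -
  have "fpath D \<nu> (V k) (rev ys) \<or> cut_fork D \<nu> (V k) (rev ys)"
    using assms(1) fpath_rev cut_fork_rev by blast
  then have "dpath D \<nu> (V k) (rev ys) \<or> (\<exists>\<mu> zs. \<mu> \<noteq> Bot \<and> dpath D (V k) \<mu> zs \<and> hd zs = last (rev ys))"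
    using assms(2) by (rule path_arrival)
  moreover have "ys \<noteq> []"
    using assms(1) unfolding fpath_def cut_fork_def dpath_def by auto
  ultimately show ?thesis
    by (simp add: last_rev)
qed

section \<open>Flows of polarised derivations are cycle-free\<close>

locale polarity =
  fixes bar :: "'a \<Rightarrow> 'a" and pol :: "'a \<Rightarrow> bool"
  assumes bar_bar: "\<And>a. bar (bar a) = a"
    and bar_neq: "\<And>a. bar a \<noteq> a"
    and pol_bar: "\<And>a. pol (bar a) = (\<not> pol a)"

locale polarised_deriv = polarity +
  fixes fs :: "'a tfm list" and st :: "'a step list"
  assumes sks: "sks_deriv bar (fs, st)"
    and even_iff_pol: "\<And>k a e. k < length fs \<Longrightarrow> (a, e) \<in> set (occs (fs ! k)) \<Longrightarrow> even e = pol a"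
    and interaction_reaches_conclusion: "\<And>k u l. k < length st \<Longrightarrow>
          step_info (st ! k) = Some (Interaction, u, l) \<Longrightarrow> \<exists>s \<in> set l. s \<in> set (tags (last fs))"
begin

lemmas length_fs = sks_deriv_length[OF sks]
  and last_fs = sks_deriv_last[OF sks]
  and step_nth = sks_deriv_step[OF sks]

lemma distinct_tags: "k < length fs \<Longrightarrow> distinct (tags (fs ! k))"
  using sks by (simp add: sks_deriv_def Let_def)

lemma lower_edge_fresh:
  "k < length st \<Longrightarrow> step_info (st ! k) = Some (c, u, l) \<Longrightarrow> e \<in> set l \<Longrightarrow> j \<le> k \<Longrightarrow> e \<notin> set (tags (fs ! j))"
  using sks unfolding sks_deriv_def Let_def by auto

lemma vertex_redexes:
  assumes "k < length st" "step_info (st ! k) = Some (c, u, l)"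
  shows "\<exists>C r r'. fs ! k = plug C r \<and> fs ! Suc k = plug C r' \<and> rule_inst bar r r' (Some (c, u, l))
           \<and> tags r = u \<and> tags r' = l"
proof -
  obtain C r r' v where "st ! k = (C, r, r', v)" "fs ! k = plug C r" "fs ! Suc k = plug C r'" "rule_inst bar r r' v"
    using step_nth[OF assms(1)] by blast
  moreover have "v = Some (c, u, l)"
    using assms(2) calculation(1) by (simp add: step_info_def)
  ultimately show ?thesis
    using rule_inst_Some_tags by blast
qed

lemma vertex_redexes_polarised:
  assumes "k < length st" "step_info (st ! k) = Some (c, u, l)"
  shows "\<exists>r r'. rule_inst bar r r' (Some (c, u, l)) \<and> tags r = u \<and> tags r' = l
           \<and> (\<forall>(a, e) \<in> set (occs r) \<union> set (occs r'). even e = pol a)"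
proof -
  obtain C r r' where v: "fs ! k = plug C r" "fs ! Suc k = plug C r'" "rule_inst bar r r' (Some (c, u, l))"
      "tags r = u" "tags r' = l"
    using vertex_redexes[OF assms] by blast
  have "k < length fs" "Suc k < length fs"
    using assms(1) length_fs by auto
  then have "\<forall>(a, e) \<in> set (occs r) \<union> set (occs r'). even e = pol a"
    using v(1,2) even_iff_pol by (fastforce simp: occs_plug)
  with v show ?thesis
    by blast
qed

lemma cut_vertex:
  "k < length st \<Longrightarrow> step_info (st ! k) = Some (Cut, u, l) \<Longrightarrow> l = [] \<and> (\<exists>i j. u = [i, j] \<and> even i \<noteq> even j)"
  using vertex_redexes_polarised[of k Cut u l]
  by (auto elim!: rule_inst.cases simp: tags_def pol_bar)

lemma interaction_vertex:
  "k < length st \<Longrightarrow> step_info (st ! k) = Some (Interaction, u, l) \<Longrightarrow> u = [] \<and> (\<exists>i j. l = [i, j])"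
  using vertex_redexes_polarised[of k Interaction u l]
  by (auto elim!: rule_inst.cases simp: tags_def)

lemma two_lower_edges:
  "k < length st \<Longrightarrow> step_info (st ! k) = Some (c, u, l) \<Longrightarrow> e1 \<in> set l \<Longrightarrow> e2 \<in> set l \<Longrightarrow> e1 \<noteq> e2
   \<Longrightarrow> c = Interaction \<or> (c = Cocontraction \<and> even e1 = even e2)"
  using vertex_redexes_polarised[of k c u l]
  by (auto elim!: rule_inst.cases simp: tags_def)

lemma vertex_preserves_parity:
  "lo_rel (fs, st) e (V m) \<Longrightarrow> up_rel (fs, st) e' (V m) \<Longrightarrow> even e = even e'"
  unfolding lo_rel_V up_rel_V
  using vertex_redexes_polarised[of m]
  by (auto elim!: rule_inst.cases simp: tags_def)

lemma upper_edge_in_tags: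
  "k < length st \<Longrightarrow> step_info (st ! k) = Some (c, u, l) \<Longrightarrow> e \<in> set u \<Longrightarrow> e \<in> set (tags (fs ! k))"
  using vertex_redexes[of k c u l] by (auto simp: tags_plug)

lemma edge_up_before_lo: "up_rel (fs, st) e (V a) \<Longrightarrow> lo_rel (fs, st) e (V b) \<Longrightarrow> a < b"
  unfolding up_rel_V lo_rel_V
  by (auto dest: upper_edge_in_tags lower_edge_fresh[where j = b] simp: not_less[symmetric])

lemma step_tags_subset:
  assumes "k < length st"
  shows "set (tags (fs ! Suc k)) \<subseteq> set (tags (fs ! k)) \<union> (case step_info (st ! k) of None \<Rightarrow> {} | Some (c, u, l) \<Rightarrow> set l)"
proof -
  obtain C r r' v where s: "st ! k = (C, r, r', v)" "fs ! k = plug C r" "fs ! Suc k = plug C r'" "rule_inst bar r r' v"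
    using step_nth[OF assms] by blast
  show ?thesis
  proof (cases v)
    case None
    then show ?thesis
      using s rule_inst_None_set_occs[of bar r r'] by (auto simp: tags_def occs_plug)
  next
    case (Some a)
    then obtain c u l where "v = Some (c, u, l)"
      by (cases a) auto
    then show ?thesis
      using s rule_inst_Some_tags[of bar r r' c u l] by (auto simp: tags_plug step_info_def)
  qed
qed

text \<open>Below the vertex the edge cannot occur in the context (tags are distinct) and cannot be
  created again (created edges are fresh).\<close>

lemma upper_edge_consumed:
  assumes m: "m < length st" "step_info (st ! m) = Some (c, u, l)" "e \<in> set u"
  shows "m < j \<Longrightarrow> j < length fs \<Longrightarrow> e \<notin> set (tags (fs ! j))"
proof (induction j)
  case 0
  then show ?case by simp
next
  case (Suc j)
  have e_before: "e \<in> set (tags (fs ! m))"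
    using upper_edge_in_tags m by blast
  show ?case
  proof (cases "j = m")
    case True
    obtain C r r' where v: "fs ! m = plug C r" "fs ! Suc m = plug C r'" "tags r = u" "tags r' = l"
      using vertex_redexes[OF m(1,2)] by blast
    have "distinct (map snd (ctx_left C) @ u @ map snd (ctx_right C))"
      using distinct_tags[of m] m(1) length_fs v(1,3) by (simp add: tags_plug)
    moreover have "e \<notin> set l"
      using lower_edge_fresh[OF m(1,2)] e_before by blast
    ultimately show ?thesis
      using True m(3) v(2,4) by (auto simp: tags_plug)
  next
    case False
    then have j: "m < j" "j < length st"
      using Suc.prems length_fs by auto
    have "e \<notin> (case step_info (st ! j) of None \<Rightarrow> {} | Some (c, u, l) \<Rightarrow> set l)"
      using lower_edge_fresh[OF j(2)] e_before j(1) by (auto split: option.splits)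
    then show ?thesis
      using step_tags_subset[OF j(2)] Suc j by auto
  qed
qed

lemma conclusion_edge_lo_Bot: "s \<in> set (tags (last fs)) \<Longrightarrow> lo_rel (fs, st) s \<nu> \<Longrightarrow> \<nu> = Bot"
  unfolding lo_rel_def using upper_edge_consumed[of _ _ _ _ s "length st"] length_fs last_fs by auto

lemma dpath_up_rel_mono:
  assumes "dpath (fs, st) (V a) \<nu> es"
  shows "i < length es \<Longrightarrow> \<exists>c \<ge> a. up_rel (fs, st) (es ! i) (V c)"
proof (induction i)
  case 0
  then show ?case
    using assms by (auto simp: dpath_def hd_conv_nth)
next
  case (Suc i)
  then obtain c where c: "c \<ge> a" "up_rel (fs, st) (es ! i) (V c)"
    by auto
  obtain m where m: "lo_rel (fs, st) (es ! i) (V m)" "up_rel (fs, st) (es ! Suc i) (V m)"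
    using dpath_inner_vertex[OF assms Suc.prems] by blast
  have "c < m"
    using edge_up_before_lo c(2) m(1) by blast
  with c m show ?case
    by (auto intro: exI[of _ m])
qed

lemma dpath_V_V_less:
  assumes "dpath (fs, st) (V a) (V b) es"
  shows "a < b"
proof -
  have "es \<noteq> []"
    using assms by (simp add: dpath_def)
  then obtain c where "c \<ge> a" "up_rel (fs, st) (last es) (V c)"
    using dpath_up_rel_mono[OF assms, of "length es - 1"] by (auto simp: last_conv_nth)
  moreover have "lo_rel (fs, st) (last es) (V b)"
    using assms by (simp add: dpath_def)
  ultimately show ?thesis
    using edge_up_before_lo by fastforce
qed

lemma dpath_from_conclusion_edge:
  assumes "dpath (fs, st) \<nu>0 \<nu> es" "hd es \<in> set (tags (last fs))"
  shows "\<nu> = Bot"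
proof (cases "length es = 1")
  case True
  then have "last es = hd es"
    by (cases es) auto
  then show ?thesis
    using assms conclusion_edge_lo_Bot by (auto simp: dpath_def)
next
  case False
  then have "Suc 0 < length es"
    using assms(1) by (cases es) (auto simp: dpath_def)
  then obtain m where "lo_rel (fs, st) (es ! 0) (V m)"
    using dpath_inner_vertex[OF assms(1)] by blast
  moreover have "es ! 0 \<in> set (tags (last fs))"
    using assms by (simp add: dpath_def hd_conv_nth)
  ultimately show ?thesis
    using conclusion_edge_lo_Bot by blast
qed

lemma dpath_parity:
  assumes "dpath (fs, st) \<nu> \<nu>' es"
  shows "i < length es \<Longrightarrow> even (es ! i) = even (hd es)"
proof (induction i)
  case 0
  then show ?case
    using assms by (auto simp: dpath_def hd_conv_nth)
next
  case (Suc i)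
  then show ?case
    using dpath_inner_vertex[OF assms Suc.prems] vertex_preserves_parity by fastforce
qed

lemma dpath_last_parity:
  assumes "dpath (fs, st) \<nu> \<nu>' es"
  shows "even (last es) = even (hd es)"
proof -
  have "es \<noteq> []"
    using assms by (simp add: dpath_def)
  then show ?thesis
    using dpath_parity[OF assms, of "length es - 1"] by (simp add: last_conv_nth)
qed

lemma interaction_lower_edges_eq:
  assumes k: "k < length st" "step_info (st ! k) = Some (Interaction, u, l)"
    and "dpath (fs, st) (V k) \<mu> xs" "\<mu> \<noteq> Bot" "dpath (fs, st) (V k) \<mu>' ys" "\<mu>' \<noteq> Bot"
  shows "hd xs = hd ys"
proof -
  obtain i j where l: "l = [i, j]"
    using interaction_vertex[OF k] by blast
  obtain s where s: "s \<in> set l" "s \<in> set (tags (last fs))"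
    using interaction_reaches_conclusion[OF k] by blast
  have "hd xs \<in> set l" "hd ys \<in> set l"
    using assms(3,5) k by (auto simp: dpath_def up_rel_V)
  moreover have "hd xs \<noteq> s" "hd ys \<noteq> s"
    using dpath_from_conclusion_edge assms(3-6) s(2) by blast+
  ultimately show ?thesis
    using s(1) l by auto
qed

lemma aipath_shape:
  assumes "aipath (fs, st) \<nu> \<nu>' es" "\<nu> \<noteq> Bot" "\<nu>' \<noteq> Bot"
  shows "fpath (fs, st) \<nu> \<nu>' es \<or> cut_fork (fs, st) \<nu> \<nu>' es"
  using assms
proof (induction rule: aipath.induct)
  case (base \<nu> \<nu>' es)
  then show ?case by blast
next
  case (join \<nu> k xs \<nu>' ys)
  obtain c u l where k: "k < length st" "step_info (st ! k) = Some (c, u, l)"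
    using join.hyps(4) by (auto simp: is_vertex_def)
  have c: "c = Cut \<or> c = Interaction"
    using join.hyps(5) k by (auto simp: vertex_kind_def)
  have xs: "dpath (fs, st) \<nu> (V k) xs \<or> (\<exists>\<mu> zs. \<mu> \<noteq> Bot \<and> dpath (fs, st) (V k) \<mu> zs \<and> hd zs = last xs)"
    using path_arrival join.IH(1) join.prems by blast
  have ys: "dpath (fs, st) \<nu>' (V k) (rev ys) \<or> (\<exists>\<mu> zs. \<mu> \<noteq> Bot \<and> dpath (fs, st) (V k) \<mu> zs \<and> hd zs = hd ys)"
    using path_departure join.IH(2) join.prems by blast
  show ?case
  proof (cases "c = Cut")
    case True
    then have "\<not> up_rel (fs, st) e (V k)" for e
      using cut_vertex[OF k(1)] k(2) by (auto simp: up_rel_V)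
    then have "dpath (fs, st) \<nu> (V k) xs" "dpath (fs, st) \<nu>' (V k) (rev ys)"
      using xs ys dpath_ends(2) by blast+
    moreover have "vertex_kind (fs, st) k = Cut"
      using True k by (simp add: vertex_kind_def)
    ultimately show ?thesis
      using join.hyps(3,4) unfolding cut_fork_def by blast
  next
    case False
    then have interaction: "step_info (st ! k) = Some (Interaction, u, l)"
      using c k(2) by simp
    then have "\<not> lo_rel (fs, st) e (V k)" for e
      using interaction_vertex[OF k(1)] by (auto simp: lo_rel_V)
    then have "\<exists>\<mu> zs. \<mu> \<noteq> Bot \<and> dpath (fs, st) (V k) \<mu> zs \<and> hd zs = last xs"
      "\<exists>\<mu> zs. \<mu> \<noteq> Bot \<and> dpath (fs, st) (V k) \<mu> zs \<and> hd zs = hd ys"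
      using xs ys dpath_ends(3) by blast+
    then have "last xs = hd ys"
      using interaction_lower_edges_eq[OF k(1) interaction] by metis
    then show ?thesis
      using join.hyps(3) by contradiction
  qed
qed

lemma cut_fork_not_cycle:
  assumes v: "is_vertex (fs, st) k" and fork: "cut_fork (fs, st) (V k) (V k) es" and dis: "distinct es"
  shows False
proof -
  obtain c xs ys where es: "es = xs @ ys" and c: "is_vertex (fs, st) c" "vertex_kind (fs, st) c = Cut"
    and xs: "dpath (fs, st) (V k) (V c) xs" and ys: "dpath (fs, st) (V k) (V c) (rev ys)"
    and junction: "last xs \<noteq> hd ys"
    using fork unfolding cut_fork_def by blast
  obtain u' l' where cut: "c < length st" "step_info (st ! c) = Some (Cut, u', l')"
    using c by (auto simp: is_vertex_def vertex_kind_def)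
  obtain ck uk lk where kk: "k < length st" "step_info (st ! k) = Some (ck, uk, lk)"
    using v by (auto simp: is_vertex_def)
  have ne: "xs \<noteq> []" "ys \<noteq> []"
    using dpath_ends(1)[OF xs] dpath_ends(1)[OF ys] by auto
  have lower: "hd xs \<in> set lk" "last ys \<in> set lk"
    using dpath_ends(2)[OF xs] dpath_ends(2)[OF ys] kk ne by (auto simp: up_rel_V hd_rev)
  have "set xs \<inter> set ys = {}"
    using dis es by simp
  then have distinct_lower: "hd xs \<noteq> last ys"
    using ne by (metis disjoint_iff hd_in_set last_in_set)
  have "last xs \<in> set u'" "hd ys \<in> set u'"
    using dpath_ends(3)[OF xs] dpath_ends(3)[OF ys] cut ne by (auto simp: lo_rel_V last_rev)
  then have "even (last xs) \<noteq> even (hd ys)"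
    using cut_vertex[OF cut] junction by auto
  then have parity: "even (hd xs) \<noteq> even (last ys)"
    using dpath_last_parity[OF xs] dpath_last_parity[OF ys] ne by (simp add: hd_rev last_rev)
  show False
  proof (cases "ck = Interaction")
    case True
    then have "hd xs = hd (rev ys)"
      using interaction_lower_edges_eq[OF kk(1) _ xs _ ys] kk(2) by simp
    then show False
      using distinct_lower ne by (simp add: hd_rev)
  next
    case False
    then show False
      using two_lower_edges[OF kk lower distinct_lower] parity by simp
  qed
qed


theorem cycle_free: "cycle_free (fs, st)"
  unfolding cycle_free_def
proof clarify
  fix k es
  assume v: "is_vertex (fs, st) k" and cycle: "aipath (fs, st) (V k) (V k) es" and dis: "distinct es"
  have "\<not> fpath (fs, st) (V k) (V k) es"
    using dpath_V_V_less unfolding fpath_def by blast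
  then have "cut_fork (fs, st) (V k) (V k) es"
    using aipath_shape[OF cycle] by simp
  then show False
    using cut_fork_not_cycle v dis by blast
qed
end

section \<open>Soundness\<close>

fun eval :: "('b \<Rightarrow> bool) \<Rightarrow> 'b fm \<Rightarrow> bool" where
  "eval v FF = False"
| "eval v TT = True"
| "eval v (At a) = v a"
| "eval v (Or x y) = (eval v x \<or> eval v y)"
| "eval v (And x y) = (eval v x \<and> eval v y)"

definition complementary :: "('a \<Rightarrow> 'a) \<Rightarrow> ('a \<Rightarrow> bool) \<Rightarrow> bool" where
  "complementary bar v \<longleftrightarrow> (\<forall>a. v (bar a) = (\<not> v a))"

lemma eval_erase: "eval v (erase x) = eval (\<lambda>p. v (fst p)) x"
  by (induction x) auto

lemma eval_eq_base: "eq_base x y \<Longrightarrow> eval w x = eval w y"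
  by (induction rule: eq_base.induct) auto

lemma eval_plug_mono: "(eval w r \<Longrightarrow> eval w r') \<Longrightarrow> eval w (plug C r) \<Longrightarrow> eval w (plug C r')"
  by (induction C) auto

lemma rule_inst_sound: "rule_inst bar r r' v \<Longrightarrow> complementary bar w \<Longrightarrow> eval (\<lambda>p. w (fst p)) r \<Longrightarrow> eval (\<lambda>p. w (fst p)) r'"
  by (erule rule_inst.cases) (auto dest: eval_eq_base simp: complementary_def)

lemma sks_deriv_sound:
  assumes sks: "sks_deriv bar D" and w: "complementary bar w" and premiss: "eval w (premiss D)"
  shows "eval w (conclusion D)"
proof -
  obtain fs st where D: "D = (fs, st)"
    by force
  have len: "length fs = Suc (length st)"
    using sks_deriv_length sks D by blast
  have "eval (\<lambda>p. w (fst p)) (fs ! k)" if "k < length fs" for k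
    using that
  proof (induction k)
    case 0
    then show ?case
      using premiss D by (cases fs) (simp_all add: premiss_def eval_erase)
  next
    case (Suc k)
    then obtain C r r' v where step: "fs ! k = plug C r" "fs ! Suc k = plug C r'" "rule_inst bar r r' v"
      using sks_deriv_step[of bar fs st k] sks D len by auto
    have "eval (\<lambda>p. w (fst p)) (fs ! k)"
      using Suc by simp
    then show ?case
      using eval_plug_mono[of "\<lambda>p. w (fst p)" r r' C] rule_inst_sound[OF step(3) w] step(1,2) by simp
  qed
  then show ?thesis
    using len sks_deriv_last[of bar fs st] sks D by (simp add: conclusion_def eval_erase)
qed

section \<open>Building tagged derivations\<close>

fun ctx_comp :: "'b ctx \<Rightarrow> 'b ctx \<Rightarrow> 'b ctx" where
  "ctx_comp Hole D = D"
| "ctx_comp (COrL C b) D = COrL (ctx_comp C D) b"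
| "ctx_comp (COrR a C) D = COrR a (ctx_comp C D)"
| "ctx_comp (CAndL C b) D = CAndL (ctx_comp C D) b"
| "ctx_comp (CAndR a C) D = CAndR a (ctx_comp C D)"

lemma plug_ctx_comp: "plug (ctx_comp C D) x = plug C (plug D x)"
  by (induction C) auto

definition tags_below :: "'a tfm \<Rightarrow> nat \<Rightarrow> bool" where
  "tags_below \<phi> n \<longleftrightarrow> (\<forall>e \<in> set (tags \<phi>). e < n)"

definition created_edges :: "vinfo option \<Rightarrow> nat set" where
  "created_edges v = (case v of None \<Rightarrow> {} | Some (c, u, l) \<Rightarrow> set l)"

definition interaction_hits :: "nat set \<Rightarrow> vinfo option \<Rightarrow> bool" where
  "interaction_hits S v \<longleftrightarrow> (\<forall>u l. v = Some (Interaction, u, l) \<longrightarrow> (\<exists>s \<in> set l. s \<in> S))"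

lemma tags_below_simps [simp]:
  "tags_below FF n" "tags_below TT n" "tags_below (At (a, i)) n \<longleftrightarrow> i < n"
  "tags_below (Or x y) n \<longleftrightarrow> tags_below x n \<and> tags_below y n"
  "tags_below (And x y) n \<longleftrightarrow> tags_below x n \<and> tags_below y n"
  by (auto simp: tags_below_def tags_def)

lemma tags_below_plug:
  "tags_below (plug C x) n \<longleftrightarrow> (\<forall>p \<in> set (ctx_left C) \<union> set (ctx_right C). snd p < n) \<and> tags_below x n"
  by (auto simp: tags_below_def tags_plug)

lemma tags_below_mono: "tags_below \<phi> n \<Longrightarrow> n \<le> m \<Longrightarrow> tags_below \<phi> m"
  by (auto simp: tags_below_def)

lemma tags_below_replace: "tags_below (plug C x) n \<Longrightarrow> tags_below y m \<Longrightarrow> n \<le> m \<Longrightarrow> tags_below (plug C y) m"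
  unfolding tags_below_plug using less_le_trans by blast

lemma interaction_hits_mono: "interaction_hits S v \<Longrightarrow> S \<subseteq> S' \<Longrightarrow> interaction_hits S' v"
  unfolding interaction_hits_def by blast

lemma rule_inst_None_tags:
  "rule_inst bar r r' None \<Longrightarrow> set (tags (plug C r')) = set (tags (plug C r))"
  by (auto simp: tags_def occs_plug rule_inst_None_set_occs)

lemma rule_inst_tags:
  assumes "rule_inst bar r r' v"
  shows "set (tags (plug C r')) \<subseteq> set (tags (plug C r)) \<union> created_edges v"
proof (cases v)
  case None
  then show ?thesis
    using assms rule_inst_None_tags[of bar r r' C] by (simp add: created_edges_def)
next
  case (Some a)
  then show ?thesis
    using assms rule_inst_Some_tags[of bar r r'] by (cases a) (auto simp: tags_plug created_edges_def)
qed

lemma sks_deriv_single: "distinct (tags \<phi>) \<Longrightarrow> sks_deriv bar ([\<phi>], [])"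
  by (simp add: sks_deriv_def)

lemma sks_deriv_Cons:
  assumes sks: "sks_deriv bar (fs, st)" and hd: "hd fs = plug C r'" and rule: "rule_inst bar r r' v"
    and distinct: "distinct (tags (plug C r))"
    and fresh: "\<forall>k < Suc (length st). created_edges (step_info (((C, r, r', v) # st) ! k)) \<inter> set (tags (plug C r)) = {}"
  shows "sks_deriv bar (plug C r # fs, (C, r, r', v) # st)"
proof -
  have len: "length fs = Suc (length st)"
    using sks by (rule sks_deriv_length)
  then have fs0: "fs ! 0 = plug C r'"
    using hd by (cases fs) auto
  have steps: "\<forall>k < length st. case st ! k of (C, r, r', v) \<Rightarrow>
      fs ! k = plug C r \<and> fs ! Suc k = plug C r' \<and> rule_inst bar r r' v"
    and distincts: "\<forall>k < length fs. distinct (tags (fs ! k))"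
    and lowers: "\<forall>k < length st. \<forall>c u l. step_info (st ! k) = Some (c, u, l) \<longrightarrow>
      (\<forall>e \<in> set l. \<forall>j \<le> k. e \<notin> set (tags (fs ! j)))"
    using sks by (simp_all add: sks_deriv_def Let_def)
  have created: "e \<notin> set (tags (plug C r))"
    if "step_info (((C, r, r', v) # st) ! k) = Some (c, u, l)" "e \<in> set l" "k < Suc (length st)" for k c u l e
    using fresh that by (force simp: created_edges_def)
  let ?fs = "plug C r # fs" and ?st = "(C, r, r', v) # st"
  have "\<forall>k < length ?st. case ?st ! k of (C, r, r', v) \<Rightarrow>
      ?fs ! k = plug C r \<and> ?fs ! Suc k = plug C r' \<and> rule_inst bar r r' v"
    using steps fs0 rule by (auto simp: nth_Cons split: nat.split)
  moreover have "\<forall>k < length ?fs. distinct (tags (?fs ! k))"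
    using distincts distinct by (auto simp: nth_Cons split: nat.split)
  moreover have "\<forall>e \<in> set l. \<forall>j \<le> k. e \<notin> set (tags (?fs ! j))"
    if k: "k < length ?st" and info: "step_info (?st ! k) = Some (c, u, l)" for k c u l
  proof (intro ballI allI impI)
    fix e j
    assume e: "e \<in> set l" and j: "j \<le> k"
    show "e \<notin> set (tags (?fs ! j))"
    proof (cases j)
      case 0
      then show ?thesis
        using created[OF info e] k by simp
    next
      case (Suc j')
      then obtain k' where "k = Suc k'"
        using j by (cases k) auto
      then show ?thesis
        using lowers info e j k Suc by auto
    qed
  qed
  ultimately show ?thesis
    using len unfolding sks_deriv_def Let_def by simp
qed

context polarity
begin

definition well_tagged :: "'a tfm \<Rightarrow> bool" where
  "well_tagged \<phi> \<longleftrightarrow> distinct (tags \<phi>) \<and> (\<forall>(a, e) \<in> set (occs \<phi>). even e = pol a)"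

lemma well_tagged_simps [simp]:
  "well_tagged FF" "well_tagged TT" "well_tagged (At (a, i)) \<longleftrightarrow> even i = pol a"
  by (auto simp: well_tagged_def tags_def)

lemma well_tagged_plug:
  "well_tagged (plug C x) \<longleftrightarrow> distinct (map snd (ctx_left C) @ tags x @ map snd (ctx_right C))
     \<and> (\<forall>(a, e) \<in> set (ctx_left C) \<union> set (occs x) \<union> set (ctx_right C). even e = pol a)"
  by (auto simp: well_tagged_def tags_plug occs_plug)

lemma well_tagged_subformula: "well_tagged (plug C x) \<Longrightarrow> well_tagged x"
  unfolding well_tagged_plug by (auto simp: well_tagged_def)

lemma well_tagged_replace:
  assumes "well_tagged (plug C x)" "tags_below (plug C x) n" "well_tagged y"
    and "\<forall>e \<in> set (tags y). e \<in> set (tags x) \<or> n \<le> e"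
  shows "well_tagged (plug C y)"
proof -
  have context_below: "\<forall>p \<in> set (ctx_left C) \<union> set (ctx_right C). snd p < n"
    using assms(2) by (simp add: tags_below_plug)
  have "e \<notin> snd ` (set (ctx_left C) \<union> set (ctx_right C))" if "e \<in> set (tags y)" for e
  proof (cases "e \<in> set (tags x)")
    case True
    then show ?thesis
      using assms(1) by (auto simp: well_tagged_plug)
  next
    case False
    then have "n \<le> e"
      using assms(4) that by blast
    then show ?thesis
      using context_below by (auto dest!: bspec)
  qed
  moreover have "distinct (map snd (ctx_left C) @ tags x @ map snd (ctx_right C))"
    "\<forall>(a, e) \<in> set (ctx_left C) \<union> set (ctx_right C). even e = pol a"
    using assms(1) unfolding well_tagged_plug by auto
  moreover have "distinct (tags y)" "\<forall>(a, e) \<in> set (occs y). even e = pol a"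
    using assms(3) unfolding well_tagged_def by auto
  ultimately show ?thesis
    unfolding well_tagged_plug by auto
qed

text \<open>derivable S n \<phi> \<psi> m: a derivation from \<phi> to \<psi> through well-tagged formulae in which
  every vertex creates edges that are fresh because they lie above the current bound (n at the
  start, m at the end), and every interaction has a lower edge in S.\<close>

inductive derivable :: "nat set \<Rightarrow> nat \<Rightarrow> 'a tfm \<Rightarrow> 'a tfm \<Rightarrow> nat \<Rightarrow> bool" for S where
  refl: "well_tagged \<phi> \<Longrightarrow> tags_below \<phi> n \<Longrightarrow> n \<le> m \<Longrightarrow> derivable S n \<phi> \<phi> m"
| step: "well_tagged (plug C r) \<Longrightarrow> tags_below (plug C r) n \<Longrightarrow> rule_inst bar r r' v
    \<Longrightarrow> created_edges v \<subseteq> {n..} \<Longrightarrow> interaction_hits S v \<Longrightarrow> n \<le> n'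
    \<Longrightarrow> derivable S n' (plug C r') \<psi> m \<Longrightarrow> derivable S n (plug C r) \<psi> m"

lemma derivable_wf:
  "derivable S n \<phi> \<psi> m \<Longrightarrow> well_tagged \<phi> \<and> tags_below \<phi> n \<and> well_tagged \<psi> \<and> tags_below \<psi> m \<and> n \<le> m"
  by (induction rule: derivable.induct) (auto intro: tags_below_mono)

lemma derivable_start: "well_tagged \<phi> \<Longrightarrow> tags_below \<phi> n \<Longrightarrow> derivable S n \<phi> \<phi> n"
  by (rule derivable.refl) auto

lemma derivable_lower_bound:
  assumes "derivable S m \<chi> \<psi> k" "tags_below \<chi> n" "n \<le> m"
  shows "derivable S n \<chi> \<psi> k"
  using assms(1)
proof cases
  case refl
  then show ?thesis
    using assms(2,3) by (auto intro: derivable.refl)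
next
  case (step C r r' v n')
  moreover have "created_edges v \<subseteq> {n..}" "n \<le> n'"
    using step assms(3) by auto
  ultimately show ?thesis
    using assms(2) by (auto intro: derivable.step)
qed

lemma derivable_trans: "derivable S n \<phi> \<chi> m \<Longrightarrow> derivable S m \<chi> \<psi> k \<Longrightarrow> derivable S n \<phi> \<psi> k"
  by (induction rule: derivable.induct) (auto intro: derivable.step derivable_lower_bound)

lemma derivable_mono: "derivable S n \<phi> \<psi> m \<Longrightarrow> S \<subseteq> S' \<Longrightarrow> derivable S' n \<phi> \<psi> m"
  by (induction rule: derivable.induct) (auto intro: derivable.intros interaction_hits_mono)

lemma derivable_in_ctx:
  "derivable S n \<chi> \<chi>' m \<Longrightarrow> well_tagged (plug C \<chi>) \<Longrightarrow> tags_below (plug C \<chi>) n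
   \<Longrightarrow> derivable S n (plug C \<chi>) (plug C \<chi>') m"
proof (induction arbitrary: C rule: derivable.induct)
  case (refl \<phi> n m)
  then show ?case by (auto intro: derivable.refl)
next
  case (step D r n r' v n' \<psi> m)
  have wf: "well_tagged (plug D r') \<and> tags_below (plug D r') n'"
    using derivable_wf[OF step.hyps(7)] by blast
  have "well_tagged (plug C (plug D r'))"
    using well_tagged_replace[OF step.prems] wf rule_inst_tags[OF step.hyps(3), of D] step.hyps(4) by auto
  moreover have "tags_below (plug C (plug D r')) n'"
    using tags_below_replace[OF step.prems(2)] wf step.hyps(6) by blast
  ultimately have "derivable S n' (plug (ctx_comp C D) r') (plug C \<psi>) m"
    using step.IH by (simp add: plug_ctx_comp)
  then show ?case
    using derivable.step[OF _ _ step.hyps(3-6), of "ctx_comp C D"] step.prems by (simp add: plug_ctx_comp)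
qed

lemma derivable_subst:
  assumes "derivable S n0 \<phi> \<psi> n" "\<psi> = plug C \<chi>" "derivable S n \<chi> \<chi>' m" "\<psi>' = plug C \<chi>'"
  shows "derivable S n0 \<phi> \<psi>' m"
  using assms derivable_trans derivable_in_ctx derivable_wf by blast

lemma derivable_subformula_wf: "derivable S n0 \<phi> \<psi> n \<Longrightarrow> \<psi> = plug C \<chi> \<Longrightarrow> well_tagged \<chi> \<and> tags_below \<chi> n"
  using derivable_wf well_tagged_subformula tags_below_plug by blast

lemma derivable_extend:
  assumes "derivable S n0 \<phi> (plug C x) n" "rule_inst bar x y v" "created_edges v \<subseteq> {n..}"
    "interaction_hits S v" "well_tagged y" "tags_below y m" "n \<le> m"
  shows "derivable S n0 \<phi> (plug C y) m"
proof -
  have wf: "well_tagged (plug C x)" "tags_below (plug C x) n"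
    using derivable_wf[OF assms(1)] by auto
  have "set (tags y) \<subseteq> set (tags x) \<union> created_edges v"
    using rule_inst_tags[OF assms(2), of Hole] by simp
  then have "well_tagged (plug C y)"
    using well_tagged_replace[OF wf assms(5)] assms(3) by auto
  moreover have "tags_below (plug C y) m"
    using tags_below_replace[OF wf(2) assms(6,7)] .
  ultimately have "derivable S n (plug C x) (plug C y) m"
    using wf assms(2-4,7) by (blast intro: derivable.intros)
  then show ?thesis
    using derivable_trans assms(1) by blast
qed

lemma derivable_None:
  assumes "derivable S n0 \<phi> \<psi> n" "\<psi> = plug C x" "\<psi>' = plug C y" "rule_inst bar x y None"
  shows "derivable S n0 \<phi> \<psi>' n"
proof -
  have "mset (occs y) = mset (occs x)"
    using rule_inst_None_mset_occs[OF assms(4)] .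
  then have "well_tagged y = well_tagged x" "tags_below y n = tags_below x n"
    unfolding well_tagged_def tags_below_def tags_def
    by (metis mset_eq_imp_distinct_iff mset_map set_mset_mset)+
  moreover have "well_tagged x \<and> tags_below x n"
    using derivable_subformula_wf assms(1,2) by blast
  ultimately show ?thesis
    using derivable_extend[of S n0 \<phi> C x n y None] assms
    by (auto simp: created_edges_def interaction_hits_def)
qed

lemma derivable_eq:
  "derivable S n0 \<phi> \<psi> n \<Longrightarrow> \<psi> = plug C x \<Longrightarrow> \<psi>' = plug C y \<Longrightarrow> eq_base x y \<or> eq_base y x
   \<Longrightarrow> derivable S n0 \<phi> \<psi>' n"
  using derivable_None rule_inst.eq_l rule_inst.eq_r by blast

lemma derivable_switch:
  "derivable S n0 \<phi> \<psi> n \<Longrightarrow> \<psi> = plug C (And x (Or y z)) \<Longrightarrow> \<psi>' = plug C (Or (And x y) z)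
   \<Longrightarrow> derivable S n0 \<phi> \<psi>' n"
  using derivable_None rule_inst.switch by blast

lemma derivable_medial:
  "derivable S n0 \<phi> \<psi> n \<Longrightarrow> \<psi> = plug C (Or (And x y) (And z w)) \<Longrightarrow> \<psi>' = plug C (And (Or x z) (Or y w))
   \<Longrightarrow> derivable S n0 \<phi> \<psi>' n"
  using derivable_None rule_inst.medial by blast

lemma derivable_coweakening:
  "derivable S n0 \<phi> \<psi> n \<Longrightarrow> \<psi> = plug C (At (a, i)) \<Longrightarrow> \<psi>' = plug C TT \<Longrightarrow> derivable S n0 \<phi> \<psi>' n"
  using derivable_extend[OF _ rule_inst.aw_up] by (auto simp: created_edges_def interaction_hits_def)

lemma derivable_cut:
  "derivable S n0 \<phi> \<psi> n \<Longrightarrow> \<psi> = plug C (And (At (a, i)) (At (bar a, j))) \<Longrightarrow> \<psi>' = plug C FF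
   \<Longrightarrow> derivable S n0 \<phi> \<psi>' n"
  using derivable_extend[OF _ rule_inst.ai_up] by (auto simp: created_edges_def interaction_hits_def)

definition fresh_tag :: "nat \<Rightarrow> 'a \<Rightarrow> nat" where
  "fresh_tag n a = 2 * n + (if pol a then 0 else 1)"

lemma fresh_tag_parity [simp]: "even (fresh_tag n a) = pol a"
  by (simp add: fresh_tag_def)

lemma fresh_tag_bounds: "n \<le> fresh_tag n a" "fresh_tag n a < 2 * n + 2"
  by (auto simp: fresh_tag_def)

lemma fresh_tag_Suc_neq: "fresh_tag n a \<noteq> fresh_tag (Suc n) b"
  by (simp add: fresh_tag_def)

lemma derivable_weakening:
  "derivable S n0 \<phi> (plug C FF) n \<Longrightarrow> derivable S n0 \<phi> (plug C (At (a, fresh_tag n a))) (2 * n + 2)"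
  using derivable_extend[OF _ rule_inst.aw_down] fresh_tag_bounds[of n a]
  by (auto simp: created_edges_def interaction_hits_def)

lemma derivable_cocontraction:
  "derivable S n0 \<phi> (plug C (At (a, i))) n
   \<Longrightarrow> derivable S n0 \<phi> (plug C (And (At (a, fresh_tag n a)) (At (a, fresh_tag (Suc n) a)))) (2 * n + 4)"
  using derivable_extend[OF _ rule_inst.ac_up] fresh_tag_bounds[of n a] fresh_tag_bounds[of "Suc n" a]
    fresh_tag_Suc_neq[of n a a]
  by (auto simp: created_edges_def interaction_hits_def well_tagged_def tags_def)

lemma derivable_interaction:
  "derivable S n0 \<phi> (plug C TT) n \<Longrightarrow> fresh_tag n a \<in> S
   \<Longrightarrow> derivable S n0 \<phi> (plug C (Or (At (a, fresh_tag n a)) (At (bar a, fresh_tag (Suc n) (bar a))))) (2 * n + 4)"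
  using derivable_extend[OF _ rule_inst.ai_down] fresh_tag_bounds[of n a] fresh_tag_bounds[of "Suc n" "bar a"]
    fresh_tag_Suc_neq[of n a "bar a"]
  by (auto simp: created_edges_def interaction_hits_def well_tagged_def tags_def)

lemma well_tagged_args:
  "well_tagged (Or x y) \<Longrightarrow> well_tagged x \<and> well_tagged y"
  "well_tagged (And x y) \<Longrightarrow> well_tagged x \<and> well_tagged y"
  using well_tagged_subformula[of "COrL Hole y" x] well_tagged_subformula[of "COrR x Hole" y]
    well_tagged_subformula[of "CAndL Hole y" x] well_tagged_subformula[of "CAndR x Hole" y]
  by auto

lemma derivable_Or:
  assumes "derivable S n x x' m" "derivable S m y y' k" "well_tagged (Or x y)" "tags_below (Or x y) n"
  shows "derivable S n (Or x y) (Or x' y') k"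
proof -
  have "derivable S n (Or x y) (Or x' y) m"
    using derivable_in_ctx[OF assms(1), of "COrL Hole y"] assms(3,4) by simp
  moreover have "derivable S m (Or x' y) (Or x' y') k"
    using derivable_in_ctx[OF assms(2), of "COrR x' Hole"] derivable_wf[OF calculation] by simp
  ultimately show ?thesis
    by (rule derivable_trans)
qed

lemma derivable_And:
  assumes "derivable S n x x' m" "derivable S m y y' k" "well_tagged (And x y)" "tags_below (And x y) n"
  shows "derivable S n (And x y) (And x' y') k"
proof -
  have "derivable S n (And x y) (And x' y) m"
    using derivable_in_ctx[OF assms(1), of "CAndL Hole y"] assms(3,4) by simp
  moreover have "derivable S m (And x' y) (And x' y') k"
    using derivable_in_ctx[OF assms(2), of "CAndR x' Hole"] derivable_wf[OF calculation] by simp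
  ultimately show ?thesis
    by (rule derivable_trans)
qed

lemma tags_below_derivable_bound: "derivable S n x x' m \<Longrightarrow> tags_below y n \<Longrightarrow> tags_below y m"
  using derivable_wf tags_below_mono by blast

lemma derivable_to_TT: "well_tagged X \<Longrightarrow> tags_below X n \<Longrightarrow> \<exists>m. derivable S n X TT m"
proof (induction X arbitrary: n)
  case FF
  fix a :: 'a
  have "derivable S n FF (plug Hole FF) n"
    using derivable_start[OF FF.prems] by simp
  then have "derivable S n FF (plug Hole (At (a, fresh_tag n a))) (2 * n + 2)"
    by (rule derivable_weakening)
  then have "derivable S n FF TT (2 * n + 2)"
    by (rule derivable_coweakening[where C = Hole]) auto
  then show ?case by blast
next
  case TT
  then show ?case
    using derivable_start by blast
next
  case (At p)
  have "derivable S n (At p) TT n"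
    using derivable_coweakening[OF derivable_start[OF At.prems], of Hole "fst p" "snd p"] by simp
  then show ?case by blast
next
  case (Or Y Z)
  have wf: "well_tagged Y" "well_tagged Z" "tags_below Y n" "tags_below Z n"
    using well_tagged_args(1)[OF Or.prems(1)] Or.prems(2) by simp_all
  obtain m1 where 1: "derivable S n Y TT m1"
    using Or.IH(1)[OF wf(1,3)] by blast
  obtain m2 where 2: "derivable S m1 Z TT m2"
    using Or.IH(2)[OF wf(2) tags_below_derivable_bound[OF 1 wf(4)]] by blast
  have "derivable S n (Or Y Z) (Or TT TT) m2"
    using derivable_Or[OF 1 2 Or.prems] .
  then have "derivable S n (Or Y Z) TT m2"
    by (rule derivable_eq[where C = Hole]) (auto intro: eq_base.intros)
  then show ?case by blast
next
  case (And Y Z)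
  have wf: "well_tagged Y" "well_tagged Z" "tags_below Y n" "tags_below Z n"
    using well_tagged_args(2)[OF And.prems(1)] And.prems(2) by simp_all
  obtain m1 where 1: "derivable S n Y TT m1"
    using And.IH(1)[OF wf(1,3)] by blast
  obtain m2 where 2: "derivable S m1 Z TT m2"
    using And.IH(2)[OF wf(2) tags_below_derivable_bound[OF 1 wf(4)]] by blast
  have "derivable S n (And Y Z) (And TT TT) m2"
    using derivable_And[OF 1 2 And.prems] .
  then have "derivable S n (And Y Z) TT m2"
    by (rule derivable_eq[where C = Hole]) (auto intro: eq_base.intros)
  then show ?case by blast
qed

lemma derivable_And_exchange:
  "derivable S n0 \<phi> (And (And a b) (And c d)) n \<Longrightarrow> derivable S n0 \<phi> (And (And a c) (And b d)) n"
proof -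
  assume "derivable S n0 \<phi> (And (And a b) (And c d)) n"
  then have "derivable S n0 \<phi> (And a (And b (And c d))) n"
    by (rule derivable_eq[where C = Hole]) (auto intro: eq_base.intros)
  then have "derivable S n0 \<phi> (And a (And (And b c) d)) n"
    by (rule derivable_eq[where C = "CAndR a Hole"]) (auto intro: eq_base.intros)
  then have "derivable S n0 \<phi> (And a (And (And c b) d)) n"
    by (rule derivable_eq[where C = "CAndR a (CAndL Hole d)"]) (auto intro: eq_base.intros)
  then have "derivable S n0 \<phi> (And a (And c (And b d))) n"
    by (rule derivable_eq[where C = "CAndR a Hole"]) (auto intro: eq_base.intros)
  then show "derivable S n0 \<phi> (And (And a c) (And b d)) n"
    by (rule derivable_eq[where C = Hole]) (auto intro: eq_base.intros)
qed

lemma derivable_duplicate: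
  "well_tagged X \<Longrightarrow> tags_below X n
   \<Longrightarrow> \<exists>X1 X2 m. derivable S n X (And X1 X2) m \<and> erase X1 = erase X \<and> erase X2 = erase X"
proof (induction X arbitrary: n)
  case FF
  have "derivable S n FF (And FF FF) n"
    by (rule derivable_eq[OF derivable_start[OF FF.prems], where C = Hole]) (auto intro: eq_base.intros)
  then show ?case by force
next
  case TT
  have "derivable S n TT (And TT TT) n"
    by (rule derivable_eq[OF derivable_start[OF TT.prems], where C = Hole]) (auto intro: eq_base.intros)
  then show ?case by force
next
  case (At p)
  obtain a i where p: "p = (a, i)"
    by force
  have "derivable S n (At p) (plug Hole (At (a, i))) n"
    using derivable_start[OF At.prems] p by simp
  then have "derivable S n (At p) (And (At (a, fresh_tag n a)) (At (a, fresh_tag (Suc n) a))) (2 * n + 4)"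
    using derivable_cocontraction[of S n "At p" Hole a i] by simp
  moreover have "erase (At (a, j)) = erase (At p)" for j
    using p by simp
  ultimately show ?case
    by blast
next
  case (Or Y Z)
  have wf: "well_tagged Y" "well_tagged Z" "tags_below Y n" "tags_below Z n"
    using well_tagged_args(1)[OF Or.prems(1)] Or.prems(2) by simp_all
  obtain Y1 Y2 m1 where 1: "derivable S n Y (And Y1 Y2) m1" "erase Y1 = erase Y" "erase Y2 = erase Y"
    using Or.IH(1)[OF wf(1,3)] by blast
  obtain Z1 Z2 m2 where 2: "derivable S m1 Z (And Z1 Z2) m2" "erase Z1 = erase Z" "erase Z2 = erase Z"
    using Or.IH(2)[OF wf(2) tags_below_derivable_bound[OF 1(1) wf(4)]] by blast
  have "derivable S n (Or Y Z) (Or (And Y1 Y2) (And Z1 Z2)) m2"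
    using derivable_Or[OF 1(1) 2(1) Or.prems] .
  then have "derivable S n (Or Y Z) (And (Or Y1 Z1) (Or Y2 Z2)) m2"
    by (rule derivable_medial[where C = Hole]) auto
  then show ?case
    using 1 2 by fastforce
next
  case (And Y Z)
  have wf: "well_tagged Y" "well_tagged Z" "tags_below Y n" "tags_below Z n"
    using well_tagged_args(2)[OF And.prems(1)] And.prems(2) by simp_all
  obtain Y1 Y2 m1 where 1: "derivable S n Y (And Y1 Y2) m1" "erase Y1 = erase Y" "erase Y2 = erase Y"
    using And.IH(1)[OF wf(1,3)] by blast
  obtain Z1 Z2 m2 where 2: "derivable S m1 Z (And Z1 Z2) m2" "erase Z1 = erase Z" "erase Z2 = erase Z"
    using And.IH(2)[OF wf(2) tags_below_derivable_bound[OF 1(1) wf(4)]] by blast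
  have "derivable S n (And Y Z) (And (And Y1 Y2) (And Z1 Z2)) m2"
    using derivable_And[OF 1(1) 2(1) And.prems] .
  then have "derivable S n (And Y Z) (And (And Y1 Z1) (And Y2 Z2)) m2"
    by (rule derivable_And_exchange)
  then show ?case
    using 1 2 by fastforce
qed

end

section \<open>Excluded middle and refutations\<close>

fun conj_list :: "'b fm list \<Rightarrow> 'b fm" where
  "conj_list [] = TT"
| "conj_list (g # G) = And g (conj_list G)"

fun atom_conj :: "'b fm \<Rightarrow> bool" where
  "atom_conj TT = True"
| "atom_conj (At p) = True"
| "atom_conj (And x y) = (atom_conj x \<and> atom_conj y)"
| "atom_conj FF = False"
| "atom_conj (Or x y) = False"

lemma atom_conj_erase: "atom_conj (erase x) = atom_conj x"
  by (induction x) auto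

lemma size_erase: "size (erase x) = size x"
  by (induction x) auto

lemma erase_And_iff: "erase X = And a b \<longleftrightarrow> (\<exists>x y. X = And x y \<and> erase x = a \<and> erase y = b)"
  by (cases X) auto

lemma erase_conj_list: "erase X = erase (conj_list G) \<Longrightarrow> \<exists>G'. X = conj_list G' \<and> map erase G' = map erase G"
proof (induction G arbitrary: X)
  case Nil
  then show ?case
    by (cases X) (auto intro: exI[of _ "[]"])
next
  case (Cons g G)
  then obtain x y where "X = And x y" "erase x = erase g" "erase y = erase (conj_list G)"
    by (auto simp: erase_And_iff)
  then show ?case
    using Cons.IH[of y] by (metis conj_list.simps(2) list.simps(9))
qed

context polarity
begin

fun dual :: "'a fm \<Rightarrow> 'a fm" where
  "dual FF = TT"
| "dual TT = FF"
| "dual (At a) = At (bar a)"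
| "dual (Or x y) = And (dual x) (dual y)"
| "dual (And x y) = Or (dual x) (dual y)"

definition satisfiable :: "'a fm list \<Rightarrow> bool" where
  "satisfiable Fs \<longleftrightarrow> (\<exists>v. complementary bar v \<and> (\<forall>F \<in> set Fs. eval v F))"

lemma eval_dual: "complementary bar v \<Longrightarrow> eval v (dual B) = (\<not> eval v B)"
  by (induction B) (auto simp: complementary_def)

lemma derivable_switch_to_Or:
  "derivable S n0 \<phi> (And (Or x x') (Or y y')) n \<Longrightarrow> derivable S n0 \<phi> (Or (Or x y) (And x' y')) n"
proof -
  assume "derivable S n0 \<phi> (And (Or x x') (Or y y')) n"
  then have "derivable S n0 \<phi> (And (Or y y') (Or x x')) n"
    by (rule derivable_eq[where C = Hole]) (auto intro: eq_base.intros)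
  then have "derivable S n0 \<phi> (And (Or y y') (Or x' x)) n"
    by (rule derivable_eq[where C = "CAndR (Or y y') Hole"]) (auto intro: eq_base.intros)
  then have "derivable S n0 \<phi> (Or (And (Or y y') x') x) n"
    by (rule derivable_switch[where C = Hole]) auto
  then have "derivable S n0 \<phi> (Or (And x' (Or y y')) x) n"
    by (rule derivable_eq[where C = "COrL Hole x"]) (auto intro: eq_base.intros)
  then have "derivable S n0 \<phi> (Or (And x' (Or y' y)) x) n"
    by (rule derivable_eq[where C = "COrL (CAndR x' Hole) x"]) (auto intro: eq_base.intros)
  then have "derivable S n0 \<phi> (Or (Or (And x' y') y) x) n"
    by (rule derivable_switch[where C = "COrL Hole x"]) auto
  then have "derivable S n0 \<phi> (Or x (Or (And x' y') y)) n"
    by (rule derivable_eq[where C = Hole]) (auto intro: eq_base.intros)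
  then have "derivable S n0 \<phi> (Or x (Or y (And x' y'))) n"
    by (rule derivable_eq[where C = "COrR x Hole"]) (auto intro: eq_base.intros)
  then show "derivable S n0 \<phi> (Or (Or x y) (And x' y')) n"
    by (rule derivable_eq[where C = Hole]) (auto intro: eq_base.intros)
qed

lemma derivable_switch_to_And:
  "derivable S n0 \<phi> (And (Or x x') (Or y y')) n \<Longrightarrow> derivable S n0 \<phi> (Or (And x y) (Or x' y')) n"
proof -
  assume "derivable S n0 \<phi> (And (Or x x') (Or y y')) n"
  then have "derivable S n0 \<phi> (Or (And (Or x x') y) y') n"
    by (rule derivable_switch[where C = Hole]) auto
  then have "derivable S n0 \<phi> (Or (And y (Or x x')) y') n"
    by (rule derivable_eq[where C = "COrL Hole y'"]) (auto intro: eq_base.intros)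
  then have "derivable S n0 \<phi> (Or (Or (And y x) x') y') n"
    by (rule derivable_switch[where C = "COrL Hole y'"]) auto
  then have "derivable S n0 \<phi> (Or (And y x) (Or x' y')) n"
    by (rule derivable_eq[where C = Hole]) (auto intro: eq_base.intros)
  then show "derivable S n0 \<phi> (Or (And x y) (Or x' y')) n"
    by (rule derivable_eq[where C = "COrL Hole (Or x' y')"]) (auto intro: eq_base.intros)
qed

lemma derivable_TT_And:
  assumes "derivable S n TT x m1" "derivable S m1 TT y m2"
  shows "derivable S n TT (And x y) m2"
proof -
  have "derivable S n TT (And TT TT) n"
    by (rule derivable_eq[OF derivable_start, where C = Hole]) (auto intro: eq_base.intros)
  moreover have "derivable S n (And TT TT) (And x y) m2"
    by (rule derivable_And[OF assms]) (simp_all add: well_tagged_def tags_def)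
  ultimately show ?thesis
    by (rule derivable_trans)
qed

text \<open>Every interaction has a lower edge in B', the part that becomes the conclusion.\<close>

lemma derivable_excluded_middle:
  "\<exists>B' Bd m. derivable (set (tags B')) n TT (Or B' Bd) m \<and> erase B' = B \<and> erase Bd = dual B"
proof (induction B arbitrary: n)
  case FF
  have "derivable {} n TT (Or TT FF) n"
    by (rule derivable_eq[OF derivable_start, where C = Hole]) (auto intro: eq_base.intros)
  then have "derivable {} n TT (Or FF TT) n"
    by (rule derivable_eq[where C = Hole]) (auto intro: eq_base.intros)
  then show ?case
    by (intro exI[of _ FF] exI[of _ TT] exI[of _ n]) (simp add: tags_def)
next
  case TT
  have "derivable {} n TT (Or TT FF) n"
    by (rule derivable_eq[OF derivable_start, where C = Hole]) (auto intro: eq_base.intros)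
  then show ?case
    by (intro exI[of _ TT] exI[of _ FF] exI[of _ n]) (simp add: tags_def)
next
  case (At a)
  have "derivable {fresh_tag n a} n TT (plug Hole TT) n"
    using derivable_start by simp
  then have "derivable {fresh_tag n a} n TT (plug Hole (Or (At (a, fresh_tag n a)) (At (bar a, fresh_tag (Suc n) (bar a))))) (2 * n + 4)"
    by (rule derivable_interaction) simp
  then show ?case
    by (intro exI[of _ "At (a, fresh_tag n a)"] exI[of _ "At (bar a, fresh_tag (Suc n) (bar a))"] exI[of _ "2 * n + 4"])
      (simp add: tags_def)
next
  case (Or B1 B2)
  obtain B1' Bd1 m1 where 1: "derivable (set (tags B1')) n TT (Or B1' Bd1) m1" "erase B1' = B1" "erase Bd1 = dual B1"
    using Or.IH(1) by blast
  obtain B2' Bd2 m2 where 2: "derivable (set (tags B2')) m1 TT (Or B2' Bd2) m2" "erase B2' = B2" "erase Bd2 = dual B2"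
    using Or.IH(2) by blast
  define S where "S = set (tags (Or B1' B2'))"
  have "derivable S n TT (And (Or B1' Bd1) (Or B2' Bd2)) m2"
    using derivable_mono[OF 1(1)] derivable_mono[OF 2(1)] by (intro derivable_TT_And) (auto simp: S_def tags_def)
  then have "derivable S n TT (Or (Or B1' B2') (And Bd1 Bd2)) m2"
    by (rule derivable_switch_to_Or)
  then show ?case
    using 1 2 unfolding S_def by (intro exI[of _ "Or B1' B2'"] exI[of _ "And Bd1 Bd2"] exI[of _ m2]) simp
next
  case (And B1 B2)
  obtain B1' Bd1 m1 where 1: "derivable (set (tags B1')) n TT (Or B1' Bd1) m1" "erase B1' = B1" "erase Bd1 = dual B1"
    using And.IH(1) by blast
  obtain B2' Bd2 m2 where 2: "derivable (set (tags B2')) m1 TT (Or B2' Bd2) m2" "erase B2' = B2" "erase Bd2 = dual B2"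
    using And.IH(2) by blast
  define S where "S = set (tags (And B1' B2'))"
  have "derivable S n TT (And (Or B1' Bd1) (Or B2' Bd2)) m2"
    using derivable_mono[OF 1(1)] derivable_mono[OF 2(1)] by (intro derivable_TT_And) (auto simp: S_def tags_def)
  then have "derivable S n TT (Or (And B1' B2') (Or Bd1 Bd2)) m2"
    by (rule derivable_switch_to_And)
  then show ?case
    using 1 2 unfolding S_def by (intro exI[of _ "And B1' B2'"] exI[of _ "Or Bd1 Bd2"] exI[of _ m2]) simp
qed

lemma eval_atom_conj: "atom_conj L \<Longrightarrow> \<forall>p \<in> set (occs L). v (fst p) \<Longrightarrow> eval v (erase L)"
  by (induction L) auto

lemma atom_conj_satisfiable:
  assumes "atom_conj L" "\<nexists>a i j. (a, i) \<in> set (occs L) \<and> (bar a, j) \<in> set (occs L)"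
  shows "satisfiable [erase L]"
proof -
  define A where "A = fst ` set (occs L)"
  define v where "v a \<longleftrightarrow> a \<in> A \<or> (bar a \<notin> A \<and> pol a)" for a
  have "\<not> (a \<in> A \<and> bar a \<in> A)" for a
    using assms(2) by (force simp: A_def)
  then have "complementary bar v"
    unfolding complementary_def v_def by (metis bar_bar pol_bar)
  moreover have "eval v (erase L)"
    using assms(1) by (rule eval_atom_conj) (auto simp: v_def A_def)
  ultimately show ?thesis
    by (auto simp: satisfiable_def)
qed

lemma derivable_drop_right:
  assumes "derivable S n x x' m" "well_tagged (And x y)" "tags_below (And x y) n"
  shows "\<exists>k. derivable S n (And x y) x' k"
proof -
  have "well_tagged y" "tags_below y m"
    using well_tagged_args(2)[OF assms(2)] tags_below_derivable_bound[OF assms(1), of y] assms(3) by simp_all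
  then obtain k where "derivable S m y TT k"
    using derivable_to_TT by blast
  then have "derivable S n (And x y) (And x' TT) k"
    using derivable_And[OF assms(1) _ assms(2,3)] by blast
  then have "derivable S n (And x y) x' k"
    by (rule derivable_eq[where C = Hole]) (auto intro: eq_base.intros)
  then show ?thesis by blast
qed

lemma derivable_drop_left:
  assumes "derivable S n y y' m" "well_tagged (And x y)" "tags_below (And x y) n"
  shows "\<exists>k. derivable S n (And x y) y' k"
proof -
  have 1: "derivable S n (And x y) (And x y') m"
    using derivable_in_ctx[OF assms(1), of "CAndR x Hole"] assms(2,3) by simp
  then have wf: "well_tagged (And x y')" "tags_below (And x y') m"
    using derivable_wf by blast+
  then obtain k where "derivable S m x TT k"
    using derivable_to_TT well_tagged_args(2)[OF wf(1)] by force
  then have "derivable S m (plug (CAndL Hole y') x) (plug (CAndL Hole y') TT) k"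
    by (rule derivable_in_ctx) (use wf in simp_all)
  then have "derivable S n (And x y) (And TT y') k"
    using derivable_trans[OF 1] by simp
  then have "derivable S n (And x y) (And y' TT) k"
    by (rule derivable_eq[where C = Hole]) (auto intro: eq_base.intros)
  then have "derivable S n (And x y) y' k"
    by (rule derivable_eq[where C = Hole]) (auto intro: eq_base.intros)
  then show ?thesis by blast
qed

lemma derivable_select_atom:
  "atom_conj L \<Longrightarrow> well_tagged L \<Longrightarrow> tags_below L n \<Longrightarrow> p \<in> set (occs L) \<Longrightarrow> \<exists>m. derivable S n L (At p) m"
proof (induction L arbitrary: n)
  case (At q)
  then show ?case
    using derivable_start by fastforce
next
  case (And L1 L2)
  have wf: "well_tagged L1" "well_tagged L2" "tags_below L1 n" "tags_below L2 n"
    using well_tagged_args(2)[OF And.prems(2)] And.prems(3) by simp_all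
  show ?case
  proof (cases "p \<in> set (occs L1)")
    case True
    then obtain m where "derivable S n L1 (At p) m"
      using And.IH(1)[OF _ wf(1,3)] And.prems(1) by auto
    then show ?thesis
      using derivable_drop_right And.prems(2,3) by blast
  next
    case False
    then obtain m where "derivable S n L2 (At p) m"
      using And.IH(2)[OF _ wf(2,4)] And.prems(1,4) by auto
    then show ?thesis
      using derivable_drop_left And.prems(2,3) by blast
  qed
qed auto

lemma derivable_select_atoms:
  "atom_conj L \<Longrightarrow> well_tagged L \<Longrightarrow> tags_below L n \<Longrightarrow> p \<in> set (occs L) \<Longrightarrow> q \<in> set (occs L) \<Longrightarrow> p \<noteq> q
   \<Longrightarrow> \<exists>m. derivable S n L (And (At p) (At q)) m"
proof (induction L arbitrary: n p q)
  case (And L1 L2)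
  have wf: "well_tagged L1" "well_tagged L2" "tags_below L1 n" "tags_below L2 n"
    using well_tagged_args(2)[OF And.prems(2)] And.prems(3) by simp_all
  have atoms: "atom_conj L1" "atom_conj L2"
    using And.prems(1) by auto
  consider (left) "p \<in> set (occs L1)" "q \<in> set (occs L1)"
    | (right) "p \<in> set (occs L2)" "q \<in> set (occs L2)"
    | (apart) x y where "{x, y} = {p, q}" "x \<in> set (occs L1)" "y \<in> set (occs L2)"
  proof -
    have "p \<in> set (occs L1) \<or> p \<in> set (occs L2)" "q \<in> set (occs L1) \<or> q \<in> set (occs L2)"
      using And.prems(4,5) by auto
    then show thesis
      using that insert_commute[of p q "{}"] by blast
  qed
  then show ?case
  proof cases
    case left
    then obtain m where "derivable S n L1 (And (At p) (At q)) m"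
      using And.IH(1)[OF atoms(1) wf(1,3) _ _ And.prems(6)] by blast
    then show ?thesis
      using derivable_drop_right And.prems(2,3) by blast
  next
    case right
    then obtain m where "derivable S n L2 (And (At p) (At q)) m"
      using And.IH(2)[OF atoms(2) wf(2,4) _ _ And.prems(6)] by blast
    then show ?thesis
      using derivable_drop_left And.prems(2,3) by blast
  next
    case apart
    obtain m1 where 1: "derivable S n L1 (At x) m1"
      using derivable_select_atom[OF atoms(1) wf(1,3) apart(2)] by blast
    obtain m2 where 2: "derivable S m1 L2 (At y) m2"
      using derivable_select_atom[OF atoms(2) wf(2) tags_below_derivable_bound[OF 1 wf(4)] apart(3)] by blast
    have xy: "derivable S n (And L1 L2) (And (At x) (At y)) m2"
      using derivable_And[OF 1 2 And.prems(2,3)] .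
    show ?thesis
    proof (cases "x = p")
      case True
      then show ?thesis
        using xy apart(1) And.prems(6) by (auto simp: doubleton_eq_iff)
    next
      case False
      then have "derivable S n (And L1 L2) (And (At q) (At p)) m2"
        using xy apart(1) by (auto simp: doubleton_eq_iff)
      then have "derivable S n (And L1 L2) (And (At p) (At q)) m2"
        by (rule derivable_eq[where C = Hole]) (auto intro: eq_base.intros)
      then show ?thesis by blast
    qed
  qed
qed auto

definition refutable :: "nat set \<Rightarrow> 'a tfm \<Rightarrow> 'a tfm list \<Rightarrow> bool" where
  "refutable S L G \<longleftrightarrow> (\<forall>n. well_tagged (And L (conj_list G)) \<longrightarrow> tags_below (And L (conj_list G)) n
     \<longrightarrow> (\<exists>m. derivable S n (And L (conj_list G)) FF m))"

lemma refutable_reduce: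
  assumes "\<And>n. well_tagged (And L (conj_list G)) \<Longrightarrow> tags_below (And L (conj_list G)) n
             \<Longrightarrow> derivable S n (And L (conj_list G)) (And L' (conj_list G')) n"
    and "refutable S L' G'"
  shows "refutable S L G"
  unfolding refutable_def
proof (intro allI impI)
  fix n
  assume "well_tagged (And L (conj_list G))" "tags_below (And L (conj_list G)) n"
  then have step: "derivable S n (And L (conj_list G)) (And L' (conj_list G')) n"
    by (rule assms(1))
  then obtain m where "derivable S n (And L' (conj_list G')) FF m"
    using assms(2) derivable_wf[OF step] unfolding refutable_def by blast
  then show "\<exists>m. derivable S n (And L (conj_list G)) FF m"
    using derivable_trans[OF step] by blast
qed

lemma refutable_Nil:
  assumes "atom_conj L" "\<not> satisfiable [erase L]"
  shows "refutable S L []"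
  unfolding refutable_def
proof (intro allI impI)
  fix n
  assume "well_tagged (And L (conj_list []))" "tags_below (And L (conj_list [])) n"
  then have "derivable S n (And L TT) (And L TT) n"
    using derivable_start by simp
  then have start: "derivable S n (And L TT) L n"
    by (rule derivable_eq[where C = Hole]) (auto intro: eq_base.intros)
  obtain a i j where pair: "(a, i) \<in> set (occs L)" "(bar a, j) \<in> set (occs L)"
    using atom_conj_satisfiable assms by blast
  moreover have "(a, i) \<noteq> (bar a, j)"
    using bar_neq[of a] by auto
  ultimately obtain m where "derivable S n L (And (At (a, i)) (At (bar a, j))) m"
    using derivable_select_atoms assms(1) derivable_wf[OF start] by blast
  then have "derivable S n (And L TT) (And (At (a, i)) (At (bar a, j))) m"
    by (rule derivable_trans[OF start])
  then have "derivable S n (And L TT) FF m"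
    by (rule derivable_cut[where C = Hole]) auto
  then show "\<exists>m. derivable S n (And L (conj_list [])) FF m"
    by auto
qed

lemma refutable_TT: "refutable S L G \<Longrightarrow> refutable S L (TT # G)"
proof (rule refutable_reduce)
  fix n
  assume "well_tagged (And L (conj_list (TT # G)))" "tags_below (And L (conj_list (TT # G))) n"
  then have "derivable S n (And L (And TT (conj_list G))) (And L (And (conj_list G) TT)) n"
    by (intro derivable_eq[OF derivable_start, where C = "CAndR L Hole"]) (auto intro: eq_base.intros)
  then show "derivable S n (And L (conj_list (TT # G))) (And L (conj_list G)) n"
    by (simp, rule derivable_eq[where C = "CAndR L Hole"]) (auto intro: eq_base.intros)
qed

lemma refutable_FF: "refutable S L (FF # G)"
  unfolding refutable_def
proof (intro allI impI)
  fix n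
  assume "well_tagged (And L (conj_list (FF # G)))" "tags_below (And L (conj_list (FF # G))) n"
  then have wf: "well_tagged (And L (And FF (conj_list G)))" "tags_below (And L (And FF (conj_list G))) n"
    by simp_all
  then have "well_tagged (And FF (conj_list G))" "tags_below (And FF (conj_list G)) n"
    using well_tagged_args(2)[OF wf(1)] by simp_all
  then obtain m where "derivable S n (And FF (conj_list G)) FF m"
    using derivable_drop_right[OF derivable_start[of FF n S]] by auto
  then show "\<exists>m. derivable S n (And L (conj_list (FF # G))) FF m"
    using derivable_drop_left[OF _ wf] by simp
qed

lemma refutable_At: "refutable S (And L (At p)) G \<Longrightarrow> refutable S L (At p # G)"
proof (rule refutable_reduce)
  fix n
  assume "well_tagged (And L (conj_list (At p # G)))" "tags_below (And L (conj_list (At p # G))) n"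
  then show "derivable S n (And L (conj_list (At p # G))) (And (And L (At p)) (conj_list G)) n"
    by (intro derivable_eq[OF derivable_start, where C = Hole]) (auto intro: eq_base.intros)
qed

lemma refutable_And: "refutable S L (g1 # g2 # G) \<Longrightarrow> refutable S L (And g1 g2 # G)"
proof (rule refutable_reduce)
  fix n
  assume "well_tagged (And L (conj_list (And g1 g2 # G)))" "tags_below (And L (conj_list (And g1 g2 # G))) n"
  then show "derivable S n (And L (conj_list (And g1 g2 # G))) (And L (conj_list (g1 # g2 # G))) n"
    by (intro derivable_eq[OF derivable_start, where C = "CAndR L Hole"]) (auto intro: eq_base.intros)
qed

lemma derivable_distribute:
  "derivable S n0 \<phi> (And (And X1 X2) (Or g1 g2)) n \<Longrightarrow> derivable S n0 \<phi> (Or (And X1 g2) (And X2 g1)) n"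
proof -
  assume "derivable S n0 \<phi> (And (And X1 X2) (Or g1 g2)) n"
  then have "derivable S n0 \<phi> (And X1 (And X2 (Or g1 g2))) n"
    by (rule derivable_eq[where C = Hole]) (auto intro: eq_base.intros)
  then have "derivable S n0 \<phi> (And X1 (Or (And X2 g1) g2)) n"
    by (rule derivable_switch[where C = "CAndR X1 Hole"]) auto
  then have "derivable S n0 \<phi> (And X1 (Or g2 (And X2 g1))) n"
    by (rule derivable_eq[where C = "CAndR X1 Hole"]) (auto intro: eq_base.intros)
  then show "derivable S n0 \<phi> (Or (And X1 g2) (And X2 g1)) n"
    by (rule derivable_switch[where C = Hole]) auto
qed

lemma derivable_rotate:
  assumes "derivable S n0 \<phi> \<psi> n" "\<psi> = plug C (And (And a b) c)" "\<psi>' = plug C (And a (And c b))"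
  shows "derivable S n0 \<phi> \<psi>' n"
proof -
  have "derivable S n0 \<phi> (plug C (And a (And b c))) n"
    using assms(1,2) by (rule derivable_eq) (auto intro: eq_base.intros)
  then show ?thesis
    unfolding assms(3) by (rule derivable_eq[where C = "ctx_comp C (CAndR a Hole)"]) (auto simp: plug_ctx_comp intro: eq_base.intros)
qed

text \<open>The rest of the branch is duplicated by cocontractions and medials, and each copy is
  combined with one disjunct.\<close>

lemma derivable_branch:
  assumes "well_tagged (And L (conj_list (Or g1 g2 # G)))" "tags_below (And L (conj_list (Or g1 g2 # G))) n"
  shows "\<exists>L1 L2 G1 G2 m. derivable S n (And L (conj_list (Or g1 g2 # G)))
             (Or (And L1 (conj_list (g2 # G1))) (And L2 (conj_list (g1 # G2)))) m
           \<and> erase L1 = erase L \<and> erase L2 = erase L \<and> map erase G1 = map erase G \<and> map erase G2 = map erase G"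
proof -
  have "derivable S n (And L (And (Or g1 g2) (conj_list G))) (And L (And (conj_list G) (Or g1 g2))) n"
    using assms by (intro derivable_eq[OF derivable_start, where C = "CAndR L Hole"]) (auto intro: eq_base.intros)
  then have r1: "derivable S n (And L (conj_list (Or g1 g2 # G))) (And (And L (conj_list G)) (Or g1 g2)) n"
    by (simp, rule derivable_eq[where C = Hole]) (auto intro: eq_base.intros)
  have "well_tagged (And L (conj_list G)) \<and> tags_below (And L (conj_list G)) n"
    using derivable_subformula_wf[OF r1, of "CAndL Hole (Or g1 g2)"] by simp
  then obtain X1 X2 m where dup: "derivable S n (And L (conj_list G)) (And X1 X2) m"
      "erase X1 = erase (And L (conj_list G))" "erase X2 = erase (And L (conj_list G))"
    using derivable_duplicate by blast
  obtain L1 R1 L2 R2 where X: "X1 = And L1 R1" "X2 = And L2 R2"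
      "erase L1 = erase L" "erase L2 = erase L" "erase R1 = erase (conj_list G)" "erase R2 = erase (conj_list G)"
    using dup(2,3) by (auto simp: erase_And_iff)
  obtain G1 G2 where G: "R1 = conj_list G1" "R2 = conj_list G2" "map erase G1 = map erase G" "map erase G2 = map erase G"
    using erase_conj_list X(5,6) by metis
  have "derivable S n (And L (conj_list (Or g1 g2 # G))) (And (And X1 X2) (Or g1 g2)) m"
    by (rule derivable_subst[OF r1 _ dup(1), where C = "CAndL Hole (Or g1 g2)"]) auto
  then have "derivable S n (And L (conj_list (Or g1 g2 # G))) (Or (And (And L1 R1) g2) (And (And L2 R2) g1)) m"
    unfolding X by (rule derivable_distribute)
  then have "derivable S n (And L (conj_list (Or g1 g2 # G))) (Or (And L1 (And g2 R1)) (And (And L2 R2) g1)) m"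
    by (rule derivable_rotate[where C = "COrL Hole (And (And L2 R2) g1)"]) simp_all
  then have "derivable S n (And L (conj_list (Or g1 g2 # G)))
      (Or (And L1 (conj_list (g2 # G1))) (And L2 (conj_list (g1 # G2)))) m"
    by (rule derivable_rotate[where C = "COrR (And L1 (And g2 R1)) Hole"]) (simp_all add: G(1,2))
  then show ?thesis
    using X(3,4) G(3,4) by blast
qed

lemma refutable_Or:
  assumes branches: "\<And>L' G'. erase L' = erase L \<Longrightarrow> map erase G' = map erase G
    \<Longrightarrow> refutable S L' (g1 # G') \<and> refutable S L' (g2 # G')"
  shows "refutable S L (Or g1 g2 # G)"
  unfolding refutable_def
proof (intro allI impI)
  fix n
  assume "well_tagged (And L (conj_list (Or g1 g2 # G)))" "tags_below (And L (conj_list (Or g1 g2 # G))) n"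
  then obtain L1 L2 G1 G2 m1 where r: "derivable S n (And L (conj_list (Or g1 g2 # G)))
      (Or (And L1 (conj_list (g2 # G1))) (And L2 (conj_list (g1 # G2)))) m1"
      and L: "erase L1 = erase L" "erase L2 = erase L" and G: "map erase G1 = map erase G" "map erase G2 = map erase G"
    using derivable_branch by blast
  have "well_tagged (And L1 (conj_list (g2 # G1))) \<and> tags_below (And L1 (conj_list (g2 # G1))) m1"
    using derivable_subformula_wf[OF r, of "COrL Hole (And L2 (conj_list (g1 # G2)))"] by simp
  then obtain m2 where 1: "derivable S m1 (And L1 (conj_list (g2 # G1))) FF m2"
    using branches[OF L(1) G(1)] unfolding refutable_def by blast
  have "well_tagged (And L2 (conj_list (g1 # G2))) \<and> tags_below (And L2 (conj_list (g1 # G2))) m1"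
    using derivable_subformula_wf[OF r, of "COrR (And L1 (conj_list (g2 # G1))) Hole"] by simp
  then obtain m3 where 2: "derivable S m2 (And L2 (conj_list (g1 # G2))) FF m3"
    using branches[OF L(2) G(2)] tags_below_derivable_bound[OF 1] unfolding refutable_def by blast
  have "derivable S n (And L (conj_list (Or g1 g2 # G))) (Or FF FF) m3"
    using derivable_trans[OF r derivable_Or[OF 1 2]] derivable_wf[OF r] by simp
  then have "derivable S n (And L (conj_list (Or g1 g2 # G))) FF m3"
    by (rule derivable_eq[where C = Hole]) (auto intro: eq_base.intros)
  then show "\<exists>m. derivable S n (And L (conj_list (Or g1 g2 # G))) FF m"
    by blast
qed

lemma size_list_erase: "map erase G' = map erase G \<Longrightarrow> sum_list (map size G') = sum_list (map size G)"
  by (metis (no_types, lifting) map_eq_conv map_map o_def size_erase)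

lemma refutable_if_unsatisfiable:
  "atom_conj L \<Longrightarrow> \<not> satisfiable (map erase (L # G)) \<Longrightarrow> refutable S L G"
proof (induction "sum_list (map size G)" arbitrary: L G rule: less_induct)
  case less
  show ?case
  proof (cases G)
    case Nil
    then show ?thesis
      using refutable_Nil less.prems by simp
  next
    case (Cons g G')
    show ?thesis
    proof (cases g)
      case FF
      then show ?thesis
        using refutable_FF Cons by simp
    next
      case TT
      have "\<not> satisfiable (map erase (L # G'))"
        using less.prems(2) Cons TT by (auto simp: satisfiable_def)
      then show ?thesis
        using less.hyps[of G' L] less.prems(1) refutable_TT Cons TT by simp
    next
      case (At p)
      have "\<not> satisfiable (map erase (And L (At p) # G'))"
        using less.prems(2) Cons At by (auto simp: satisfiable_def)
      then show ?thesis
        using less.hyps[of G' "And L (At p)"] less.prems(1) refutable_At Cons At by simp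
    next
      case (And g1 g2)
      have "\<not> satisfiable (map erase (L # g1 # g2 # G'))"
        using less.prems(2) Cons And by (auto simp: satisfiable_def)
      then show ?thesis
        using less.hyps[of "g1 # g2 # G'" L] less.prems(1) refutable_And Cons And by simp
    next
      case (Or g1 g2)
      have "refutable S L' (g1 # G'') \<and> refutable S L' (g2 # G'')"
        if "erase L' = erase L" "map erase G'' = map erase G'" for L' G''
      proof -
        have "atom_conj L'"
          using less.prems(1) atom_conj_erase that(1) by metis
        moreover have "\<not> satisfiable (map erase (L' # g1 # G''))" "\<not> satisfiable (map erase (L' # g2 # G''))"
          using less.prems(2) Cons Or that by (auto simp: satisfiable_def)
        moreover have "sum_list (map size (g1 # G'')) < sum_list (map size G)"
          "sum_list (map size (g2 # G'')) < sum_list (map size G)"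
          using size_list_erase[OF that(2)] Cons Or by simp_all
        ultimately show ?thesis
          using less.hyps by blast
      qed
      then show ?thesis
        using refutable_Or Cons Or by simp
    qed
  qed
qed

section \<open>Completeness with cycle-free flows\<close>

lemma derivable_imp_sks_deriv:
  "derivable S n \<phi> \<psi> m \<Longrightarrow> \<exists>fs st. sks_deriv bar (fs, st) \<and> hd fs = \<phi> \<and> last fs = \<psi>
     \<and> (\<forall>k < length fs. well_tagged (fs ! k))
     \<and> (\<forall>k < length st. interaction_hits S (step_info (st ! k)) \<and> created_edges (step_info (st ! k)) \<subseteq> {n..})"
proof (induction rule: derivable.induct)
  case (refl \<phi> n m)
  then show ?case
    using sks_deriv_single[of \<phi> bar] by (intro exI[of _ "[\<phi>]"] exI[of _ "[]"]) (simp add: well_tagged_def)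
next
  case (step C r n r' v n' \<psi> m)
  then obtain fs st where IH: "sks_deriv bar (fs, st)" "hd fs = plug C r'" "last fs = \<psi>"
      "\<forall>k < length fs. well_tagged (fs ! k)"
      "\<forall>k < length st. interaction_hits S (step_info (st ! k)) \<and> created_edges (step_info (st ! k)) \<subseteq> {n'..}"
    by blast
  have fs: "fs \<noteq> []"
    using IH(1) by (auto simp: sks_deriv_def)
  let ?st = "(C, r, r', v) # st"
  have created: "\<forall>k < length ?st. created_edges (step_info (?st ! k)) \<subseteq> {n..}"
  proof (intro allI impI)
    fix k
    assume "k < length ?st"
    then show "created_edges (step_info (?st ! k)) \<subseteq> {n..}"
      using IH(5) step.hyps(4,6) by (cases k) (auto simp: step_info_def, fastforce)
  qed
  have "\<forall>k < Suc (length st). created_edges (step_info (?st ! k)) \<inter> set (tags (plug C r)) = {}"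
  proof (intro allI impI)
    fix k
    assume "k < Suc (length st)"
    then have "created_edges (step_info (?st ! k)) \<subseteq> {n..}"
      using created by simp
    then show "created_edges (step_info (?st ! k)) \<inter> set (tags (plug C r)) = {}"
      using step.hyps(2) unfolding tags_below_def by fastforce
  qed
  then have "sks_deriv bar (plug C r # fs, ?st)"
    using sks_deriv_Cons[OF IH(1,2) step.hyps(3)] step.hyps(1) by (simp add: well_tagged_def)
  moreover have "\<forall>k < length (plug C r # fs). well_tagged ((plug C r # fs) ! k)"
    using IH(4) step.hyps(1) by (simp add: nth_Cons split: nat.split)
  moreover have "\<forall>k < length ?st. interaction_hits S (step_info (?st ! k))"
    using IH(5) step.hyps(5) by (auto simp: nth_Cons step_info_def split: nat.split)
  ultimately show ?case
    using IH(3) fs created by (intro exI[of _ "plug C r # fs"] exI[of _ ?st]) auto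
qed

lemma well_tagged_join:
  assumes "well_tagged x" "well_tagged y" "set (tags x) \<inter> set (tags y) = {}"
  shows "well_tagged (Or x y)" "well_tagged (And x y)"
  using assms by (auto simp: well_tagged_def tags_def)

lemma exists_tagging: "\<exists>A' m. erase A' = A \<and> well_tagged A' \<and> set (tags A') \<subseteq> {n..<m} \<and> n \<le> m"
proof (induction A arbitrary: n)
  case FF
  then show ?case
    by (intro exI[of _ FF] exI[of _ n]) (simp add: tags_def)
next
  case TT
  then show ?case
    by (intro exI[of _ TT] exI[of _ n]) (simp add: tags_def)
next
  case (At a)
  then show ?case
    using fresh_tag_bounds[of n a]
    by (intro exI[of _ "At (a, fresh_tag n a)"] exI[of _ "2 * n + 2"]) (simp add: tags_def)
next
  case (Or A1 A2)
  obtain X1 m1 where 1: "erase X1 = A1" "well_tagged X1" "set (tags X1) \<subseteq> {n..<m1}" "n \<le> m1"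
    using Or.IH(1) by blast
  obtain X2 m2 where 2: "erase X2 = A2" "well_tagged X2" "set (tags X2) \<subseteq> {m1..<m2}" "m1 \<le> m2"
    using Or.IH(2) by blast
  have "set (tags X1) \<inter> set (tags X2) = {}"
    using 1(3) 2(3) by fastforce
  then show ?case
    using 1 2 well_tagged_join(1)[OF 1(2) 2(2)]
    by (intro exI[of _ "Or X1 X2"] exI[of _ m2]) (auto simp: tags_def)
next
  case (And A1 A2)
  obtain X1 m1 where 1: "erase X1 = A1" "well_tagged X1" "set (tags X1) \<subseteq> {n..<m1}" "n \<le> m1"
    using And.IH(1) by blast
  obtain X2 m2 where 2: "erase X2 = A2" "well_tagged X2" "set (tags X2) \<subseteq> {m1..<m2}" "m1 \<le> m2"
    using And.IH(2) by blast
  have "set (tags X1) \<inter> set (tags X2) = {}"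
    using 1(3) 2(3) by fastforce
  then show ?case
    using 1 2 well_tagged_join(2)[OF 1(2) 2(2)]
    by (intro exI[of _ "And X1 X2"] exI[of _ m2]) (auto simp: tags_def)
qed

lemma derivable_excluded_middle_in:
  assumes "well_tagged A" "tags_below A n" "derivable S n TT (Or B Bd) m"
  shows "derivable S n A (Or (And TT (conj_list [A, Bd])) B) m"
proof -
  have "derivable S n A (And A TT) n"
    by (rule derivable_eq[OF derivable_start[OF assms(1,2)], where C = Hole]) (auto intro: eq_base.intros)
  then have "derivable S n A (And A (Or B Bd)) m"
    by (rule derivable_subst[OF _ _ assms(3), where C = "CAndR A Hole"]) auto
  then have "derivable S n A (And A (Or Bd B)) m"
    by (rule derivable_eq[where C = "CAndR A Hole"]) (auto intro: eq_base.intros)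
  then have "derivable S n A (Or (And A Bd) B) m"
    by (rule derivable_switch[where C = Hole]) auto
  then have "derivable S n A (Or (And A (And Bd TT)) B) m"
    by (rule derivable_eq[where C = "COrL (CAndR A Hole) B"]) (auto intro: eq_base.intros)
  then have "derivable S n A (Or (And (And A (And Bd TT)) TT) B) m"
    by (rule derivable_eq[where C = "COrL Hole B"]) (auto intro: eq_base.intros)
  then show ?thesis
    by (rule derivable_eq[where C = "COrL Hole B"]) (auto intro: eq_base.intros)
qed

lemma derivable_of_consequence:
  assumes "\<forall>v. complementary bar v \<longrightarrow> eval v A \<longrightarrow> eval v B"
  shows "\<exists>A' B' n m. erase A' = A \<and> erase B' = B \<and> derivable (set (tags B')) n A' B' m"
proof -
  obtain A' n where A': "erase A' = A" "well_tagged A'" "set (tags A') \<subseteq> {0..<n}"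
    using exists_tagging[of A 0] by blast
  obtain B' Bd m1 where B': "derivable (set (tags B')) n TT (Or B' Bd) m1" "erase B' = B" "erase Bd = dual B"
    using derivable_excluded_middle by blast
  define S where "S = set (tags B')"
  have "tags_below A' n"
    using A'(3) by (auto simp: tags_below_def)
  then have r: "derivable S n A' (Or (And TT (conj_list [A', Bd])) B') m1"
    using derivable_excluded_middle_in A'(2) B'(1) unfolding S_def by blast
  have "\<not> satisfiable (map erase [TT, A', Bd])"
    using assms A'(1) B'(2,3) eval_dual by (auto simp: satisfiable_def)
  then have "refutable S TT [A', Bd]"
    by (rule refutable_if_unsatisfiable[rotated]) simp
  then obtain m where refutation: "derivable S m1 (And TT (conj_list [A', Bd])) FF m"
    using derivable_subformula_wf[OF r, of "COrL Hole B'"] unfolding refutable_def by auto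
  have "derivable S n A' (Or FF B') m"
    using derivable_subst[OF r _ refutation, where C = "COrL Hole B'"] by simp
  then have "derivable S n A' (Or B' FF) m"
    by (rule derivable_eq[where C = Hole]) (auto intro: eq_base.intros)
  then have "derivable S n A' B' m"
    by (rule derivable_eq[where C = Hole]) (auto intro: eq_base.intros)
  then show ?thesis
    using A'(1) B'(2) unfolding S_def by blast
qed

theorem polarised_deriv_of_consequence:
  assumes "\<forall>v. complementary bar v \<longrightarrow> eval v A \<longrightarrow> eval v B"
  shows "\<exists>fs st. polarised_deriv bar pol fs st \<and> erase (hd fs) = A \<and> erase (last fs) = B"
proof -
  obtain A' B' n m where AB: "erase A' = A" "erase B' = B" "derivable (set (tags B')) n A' B' m"
    using derivable_of_consequence[OF assms] by blast
  obtain fs st where D: "sks_deriv bar (fs, st)" "hd fs = A'" "last fs = B'"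
      "\<forall>k < length fs. well_tagged (fs ! k)"
      "\<forall>k < length st. interaction_hits (set (tags B')) (step_info (st ! k))"
    using derivable_imp_sks_deriv[OF AB(3)] by blast
  have "polarised_deriv bar pol fs st"
  proof
    show "sks_deriv bar (fs, st)"
      by (rule D(1))
    show "even e = pol a" if "k < length fs" "(a, e) \<in> set (occs (fs ! k))" for k a e
      using D(4) that by (fastforce simp: well_tagged_def)
    show "\<exists>s \<in> set l. s \<in> set (tags (last fs))"
      if "k < length st" "step_info (st ! k) = Some (Interaction, u, l)" for k u l
      using D(3,5) that by (auto simp: interaction_hits_def)
  qed
  then show ?thesis
    using AB D(2,3) by blast
qed

end

lemma polarity_exists:
  assumes "\<And>a. bar (bar a) = a" "\<And>a. bar a \<noteq> a"
  shows "\<exists>pol. polarity bar pol"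
proof -
  define pol where "pol a \<longleftrightarrow> a = (SOME x. x = a \<or> x = bar a)" for a
  have "pol (bar a) = (\<not> pol a)" for a
  proof -
    have same_pair: "(\<lambda>x. x = bar a \<or> x = bar (bar a)) = (\<lambda>x. x = a \<or> x = bar a)"
      using assms(1) by auto
    have "(SOME x. x = a \<or> x = bar a) = a \<or> (SOME x. x = a \<or> x = bar a) = bar a"
      by (rule someI[of _ a]) simp
    then show ?thesis
      unfolding pol_def same_pair using assms(2)[of a] by auto
  qed
  then show ?thesis
    unfolding polarity_def using assms by blast
qed

theorem theorem5p17:
  fixes bar :: "'a \<Rightarrow> 'a" and \<Phi> :: "'a deriv"
  assumes "\<And>a. bar (bar a) = a"
    and "\<And>a. bar a \<noteq> a"
    and "sks_deriv bar \<Phi>"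
  shows "\<exists>\<Psi>. sks_deriv bar \<Psi> \<and> premiss \<Psi> = premiss \<Phi>
             \<and> conclusion \<Psi> = conclusion \<Phi> \<and> cycle_free \<Psi>"
proof -
  obtain pol where "polarity bar pol"
    using polarity_exists assms(1,2) by blast
  moreover have "\<forall>v. complementary bar v \<longrightarrow> eval v (premiss \<Phi>) \<longrightarrow> eval v (conclusion \<Phi>)"
    using sks_deriv_sound[OF assms(3)] by blast
  ultimately obtain fs st where "polarised_deriv bar pol fs st"
      "erase (hd fs) = premiss \<Phi>" "erase (last fs) = conclusion \<Phi>"
    using polarity.polarised_deriv_of_consequence by blast
  then show ?thesis
    using polarised_deriv.sks polarised_deriv.cycle_free
    by (intro exI[of _ "(fs, st)"]) (auto simp: premiss_def conclusion_def)
qed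

end
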